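(* Let $Q$ be a row-finite quiver, and let $k$ be an infinite field. Fix for each rational class $[p]\in\widetilde{Q}^{\rm rat}_\infty$ a simple oriented cycle $q=\alpha_n\cdots\alpha_2\alpha_1$ with $p\sim q^\infty$, and for $\lambda\in k^\times$ let $\mathcal{F}^\lambda_{[p]}=\mathcal{F}_{[p]}^{{\bf a}_{\lambda,q}}$, where ${\bf a}_{\lambda,q}=(a_\alpha)_{\alpha\in Q_1}$ is given by $a_{\alpha_1}=\lambda$ and $a_\alpha=1$ for $\alpha\ne\alpha_1$. Then the representation $$\mathcal{S}=\Big(\bigoplus_{[p]\in\widetilde{Q}_\infty^{\rm irr}}\mathcal{F}_{[p]}\Big)\oplus\Big(\bigoplus_{\lambda\in k^\times,\,[p]\in\widetilde{Q}^{\rm rat}_\infty}\mathcal{F}_{[p]}^\lambda\Big)\oplus\Big(\bigoplus_{i\in Q_0^s}\mathcal{N}_i\Big)$$ of $L_k(Q)$ is faithful.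
   Context: A quiver $Q=(Q_0,Q_1;s,t)$ consists of a set $Q_0$ of vertices, a set $Q_1$ of arrows and maps $s,t\colon Q_1\to Q_0$ (starting and terminating vertex). A vertex is a sink if no arrow starts at it, an infinite emitter if infinitely many arrows start at it, and regular if it is neither. $Q$ is row-finite if it has no infinite emitter. $Q_0^s$ is the set of sinks. A finite path of length $n\ge1$ is a sequence $p=\alpha_n\cdots\alpha_2\alpha_1$ of arrows with $t(\alpha_i)=s(\alpha_{i+1})$; $s(p)=s(\alpha_1)$, $t(p)=t(\alpha_n)$; for each vertex $i$ there is a trivial path $e_i$ of length $0$ with $s(e_i)=t(e_i)=i$. Concatenation is written from right to left. An oriented cycle is a nontrivial path $p$ with $s(p)=t(p)$; it is simple if it is not a power of a shorter oriented cycle. Leavitt path algebra: $L_k(Q)$ is the $k$-algebra (algebras are not required to be unital) given by generators $\{e_i,\alpha,\alpha^*\mid i\in Q_0,\alpha\in Q_1\}$ subject to: (0) $e_ie_j=\delta_{ij}e_i$ for $i,j\in Q_0$; (1) $e_{t(\alpha)}\alpha=\alpha=\alpha e_{s(\alpha)}$; (2) $e_{s(\alpha)}\alpha^*=\alpha^*=\alpha^*e_{t(\alpha)}$; (3) $\alpha\beta^*=\delta_{\alpha,\beta}e_{t(\alpha)}$ for $\alpha,\beta\in Q_1$; (4) $\sum_{\{\alpha\in Q_1\mid s(\alpha)=i\}}\alpha^*\alpha=e_i$ for every regular vertex $i$. A representation is a $k$-vector space $M$ with an algebra homomorphism $L_k(Q)\to{\rm End}_k(M)$; it is faithful if this homomorphism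 is injective. A left-infinite path is an infinite sequence $p=\cdots\alpha_n\cdots\alpha_2\alpha_1$ of arrows with $t(\alpha_i)=s(\alpha_{i+1})$ for all $i\ge1$; $s(p)=s(\alpha_1)$; $Q_\infty$ is the set of them. For $n\ge0$, $\tau_{>n}(p)=\cdots\alpha_{n+2}\alpha_{n+1}$. Left-infinite paths $p,q$ are tail-equivalent, $p\sim q$, if $\tau_{>n}(p)=\tau_{>m}(q)$ for some $n,m\ge0$; $[p]$ is the class of $p$. For an oriented cycle $q$, $q^\infty=\cdots q\cdots qq$; such left-infinite paths are called cyclic. A left-infinite path $p$ is rational if it is tail-equivalent to a cyclic path (then $p\sim q^\infty$ for a simple oriented cycle $q$), and irrational otherwise. $\widetilde{Q}_\infty^{\rm rat}$ and $\widetilde{Q}_\infty^{\rm irr}$ are the sets of classes of rational, resp. irrational, left-infinite paths. $\mathcal{F}$ is the $k$-vector space with basis $Q_\infty$, with $L_k(Q)$-action, for $p=\cdots\alpha_2\alpha_1$: $e_i.p=\delta_{i,s(p)}p$; $\alpha.p=\delta_{\alpha,\alpha_1}\tau_{>1}(p)$; $\alpha^*.p=p\alpha$ if $t(\alpha)=s(p)$ and $0$ otherwise. $\mathcal{F}_{[p]}$ is the subrepresentation spanned by $\{q\mid q\in[p]\}$. $\mathcal{N}$ is the $k$-vector space with basis the finite paths terminating at a sink (trivial paths at sinks included), with action: $e_i.p=\delta_{i,s(p)}p$; $\alpha.p=0$ if $p$ has length $0$, and $\alpha.p=\delta_{\alpha,\alpha_1}\,\alpha_n\cdots\alpha_2$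 for $p=\alpha_n\cdots\alpha_2\alpha_1$ (read as $e_{t(\alpha_1)}$ when $n=1$); $\alpha^*.p=p\alpha$ if $t(\alpha)=s(p)$ and $0$ otherwise. For a sink $i$, $\mathcal{N}_i$ is the subrepresentation spanned by the paths $p$ with $t(p)=i$. Twisting: $k^\times$ is the multiplicative group of $k$. For ${\bf a}=(a_\alpha)_{\alpha\in Q_1}\in(k^\times)^{Q_1}$, $\gamma_{\bf a}$ is the algebra automorphism of $L_k(Q)$ with $\gamma_{\bf a}(e_i)=e_i$, $\gamma_{\bf a}(\alpha)=a_\alpha\alpha$, $\gamma_{\bf a}(\alpha^* )=a_\alpha^{-1}\alpha^*$. For a representation $M$, the twisted representation $M^{\bf a}$ is $M$ as a vector space, with $u\in L_k(Q)$ acting on $M^{\bf a}$ as $\gamma_{\bf a}(u)$ acts on $M$. *)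

theory Defs
  imports
    "HOL-Library.Poly_Mapping"
    "HOL-Library.Product_Plus"
    "HOL-Library.FuncSet"
    "Graph_Theory.Arc_Walk"
begin

text \<open>
  A quiver is a directed multigraph \<^typ>\<open>('v, 'e) pre_digraph\<close> satisfying \<^locale>\<open>wf_digraph\<close>, with
  \<^const>\<open>tail\<close> for the starting and \<^const>\<open>head\<close> for the terminating vertex of an arrow.

  Paths are composed from right to left in the mathematics, but stored here in the order of
  traversal: the path \<open>\<alpha>_n \<dots> \<alpha>_2 \<alpha>_1\<close> is the list \<open>[\<alpha>_1, \<alpha>_2, \<dots>, \<alpha>_n]\<close>, and the left-infinite
  path \<open>\<dots> \<alpha>_2 \<alpha>_1\<close> is the sequence \<open>p\<close> with \<open>p 0 = \<alpha>_1\<close>, \<open>p 1 = \<alpha>_2\<close>, and so on.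
\<close>

section \<open>Quivers\<close>

definition sinks :: "('v, 'e) pre_digraph \<Rightarrow> 'v set" where
  "sinks Q = {i \<in> verts Q. out_arcs Q i = {}}"

definition infinite_emitters :: "('v, 'e) pre_digraph \<Rightarrow> 'v set" where
  "infinite_emitters Q = {i \<in> verts Q. infinite (out_arcs Q i)}"

definition regular_verts :: "('v, 'e) pre_digraph \<Rightarrow> 'v set" where
  "regular_verts Q = verts Q - sinks Q - infinite_emitters Q"

definition row_finite :: "('v, 'e) pre_digraph \<Rightarrow> bool" where
  "row_finite Q \<longleftrightarrow> infinite_emitters Q = {}"

definition oriented_cycle :: "('v, 'e) pre_digraph \<Rightarrow> 'e list \<Rightarrow> bool" where
  "oriented_cycle Q c \<longleftrightarrow> c \<noteq> [] \<and> (\<exists>v. pre_digraph.awalk Q v c v)"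

definition simple_cycle :: "('v, 'e) pre_digraph \<Rightarrow> 'e list \<Rightarrow> bool" where
  "simple_cycle Q c \<longleftrightarrow> oriented_cycle Q c \<and>
     \<not> (\<exists>d m. oriented_cycle Q d \<and> length d < length c \<and> c = concat (replicate m d))"

text \<open>
  A finite path is encoded as a pair of its starting vertex and its list of arrows, so that the
  trivial path at \<open>i\<close> is \<open>(i, [])\<close>.
\<close>

definition paths_ending_at :: "('v, 'e) pre_digraph \<Rightarrow> 'v \<Rightarrow> ('v \<times> 'e list) set" where
  "paths_ending_at Q i = {(v, p). pre_digraph.awalk Q v p i}"

definition left_inf_paths :: "('v, 'e) pre_digraph \<Rightarrow> (nat \<Rightarrow> 'e) set" where
  "left_inf_paths Q = {p. \<forall>n. p n \<in> arcs Q \<and> head Q (p n) = tail Q (p (Suc n))}"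

definition tau :: "nat \<Rightarrow> (nat \<Rightarrow> 'e) \<Rightarrow> (nat \<Rightarrow> 'e)" where
  "tau n p = (\<lambda>i. p (n + i))"

definition tail_equiv :: "(nat \<Rightarrow> 'e) \<Rightarrow> (nat \<Rightarrow> 'e) \<Rightarrow> bool" where
  "tail_equiv p q \<longleftrightarrow> (\<exists>n m. tau n p = tau m q)"

definition tail_class :: "('v, 'e) pre_digraph \<Rightarrow> (nat \<Rightarrow> 'e) \<Rightarrow> (nat \<Rightarrow> 'e) set" where
  "tail_class Q p = {q \<in> left_inf_paths Q. tail_equiv p q}"

definition cycle_inf :: "'e list \<Rightarrow> (nat \<Rightarrow> 'e)" where
  "cycle_inf c = (\<lambda>n. c ! (n mod length c))"

definition rational_path :: "('v, 'e) pre_digraph \<Rightarrow> (nat \<Rightarrow> 'e) \<Rightarrow> bool" where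
  "rational_path Q p \<longleftrightarrow>
     p \<in> left_inf_paths Q \<and> (\<exists>c. oriented_cycle Q c \<and> tail_equiv p (cycle_inf c))"

definition rational_classes :: "('v, 'e) pre_digraph \<Rightarrow> (nat \<Rightarrow> 'e) set set" where
  "rational_classes Q = tail_class Q ` {p. rational_path Q p}"

definition irrational_classes :: "('v, 'e) pre_digraph \<Rightarrow> (nat \<Rightarrow> 'e) set set" where
  "irrational_classes Q = tail_class Q ` {p \<in> left_inf_paths Q. \<not> rational_path Q p}"


section \<open>Not necessarily unital algebras over a field\<close>

record ('k, 'a) nalgebra =
  acarrier :: "'a set"
  aplus :: "'a \<Rightarrow> 'a \<Rightarrow> 'a"
  amult :: "'a \<Rightarrow> 'a \<Rightarrow> 'a"
  ascale :: "'k \<Rightarrow> 'a \<Rightarrow> 'a"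

definition nalgebra_hom ::
  "('k, 'a) nalgebra \<Rightarrow> ('k, 'b) nalgebra \<Rightarrow> ('a \<Rightarrow> 'b) \<Rightarrow> bool" where
  "nalgebra_hom A B \<phi> \<longleftrightarrow>
     \<phi> \<in> acarrier A \<rightarrow> acarrier B \<and>
     (\<forall>x \<in> acarrier A. \<forall>y \<in> acarrier A. \<phi> (aplus A x y) = aplus B (\<phi> x) (\<phi> y)) \<and>
     (\<forall>x \<in> acarrier A. \<forall>y \<in> acarrier A. \<phi> (amult A x y) = amult B (\<phi> x) (\<phi> y)) \<and>
     (\<forall>c. \<forall>x \<in> acarrier A. \<phi> (ascale A c x) = ascale B c (\<phi> x))"

text \<open>
  Endomorphisms of a subspace \<open>V\<close> are represented by functions that are \<^const>\<open>undefined\<close>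
  outside \<open>V\<close>, so that equality of endomorphisms is equality of functions.
\<close>

definition End_alg ::
  "'m::ab_group_add set \<Rightarrow> ('k \<Rightarrow> 'm \<Rightarrow> 'm) \<Rightarrow> ('k, 'm \<Rightarrow> 'm) nalgebra" where
  "End_alg V s =
     \<lparr> acarrier = {f \<in> V \<rightarrow>\<^sub>E V. (\<forall>x \<in> V. \<forall>y \<in> V. f (x + y) = f x + f y) \<and>
                              (\<forall>c. \<forall>x \<in> V. f (s c x) = s c (f x))},
       aplus = (\<lambda>f g. \<lambda>x \<in> V. f x + g x),
       amult = (\<lambda>f g. compose V f g),
       ascale = (\<lambda>c f. \<lambda>x \<in> V. s c (f x)) \<rparr>"


section \<open>Free algebras and free vector spaces\<close>

instantiation list :: (type) monoid_add
begin

definition zero_list :: "'a list" where "zero_list = []"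

definition plus_list :: "'a list \<Rightarrow> 'a list \<Rightarrow> 'a list" where "plus_list = (@)"

instance by standard (simp_all add: zero_list_def plus_list_def)

end

text \<open>
  With concatenation as addition on words, the convolution product of \<^theory>\<open>HOL-Library.Poly_Mapping\<close>
  makes \<^typ>\<open>'g list \<Rightarrow>\<^sub>0 'k\<close> the free unital algebra on \<^typ>\<open>'g\<close>. The free non-unital algebra on a
  set \<open>G\<close> of generators consists of the linear combinations of non-empty words over \<open>G\<close>.
\<close>

definition pm_scale :: "'k \<Rightarrow> ('b \<Rightarrow>\<^sub>0 'k) \<Rightarrow> ('b \<Rightarrow>\<^sub>0 'k::field)" where
  "pm_scale c = Poly_Mapping.map ((*) c)"

definition lin_ext :: "('b \<Rightarrow> ('c \<Rightarrow>\<^sub>0 'k)) \<Rightarrow> ('b \<Rightarrow>\<^sub>0 'k) \<Rightarrow> ('c \<Rightarrow>\<^sub>0 'k::field)" where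
  "lin_ext g f = (\<Sum>b \<in> Poly_Mapping.keys f. pm_scale (Poly_Mapping.lookup f b) (g b))"

definition basis_vec :: "'b \<Rightarrow> ('b \<Rightarrow>\<^sub>0 'k::field)" where
  "basis_vec b = Poly_Mapping.single b 1"

definition free_space :: "'b set \<Rightarrow> ('b \<Rightarrow>\<^sub>0 'k::field) set" where
  "free_space B = {f. Poly_Mapping.keys f \<subseteq> B}"

definition free_nalg :: "'g set \<Rightarrow> ('g list \<Rightarrow>\<^sub>0 'k::field) set" where
  "free_nalg G = free_space (lists G - {[]})"

definition gen :: "'g \<Rightarrow> ('g list \<Rightarrow>\<^sub>0 'k::field)" where
  "gen g = basis_vec [g]"


section \<open>Leavitt path algebras\<close>

datatype ('v, 'e) lgen = Vert 'v | Arr 'e | Ghost 'e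

type_synonym ('v, 'e, 'k) lfree = "('v, 'e) lgen list \<Rightarrow>\<^sub>0 'k"

definition lgens :: "('v, 'e) pre_digraph \<Rightarrow> ('v, 'e) lgen set" where
  "lgens Q = Vert ` verts Q \<union> Arr ` arcs Q \<union> Ghost ` arcs Q"

definition lpa_free :: "('v, 'e) pre_digraph \<Rightarrow> ('v, 'e, 'k::field) lfree set" where
  "lpa_free Q = free_nalg (lgens Q)"

inductive_set lpa_rels :: "('v, 'e) pre_digraph \<Rightarrow> ('v, 'e, 'k::field) lfree set"
  for Q :: "('v, 'e) pre_digraph" where
  rel0: "i \<in> verts Q \<Longrightarrow> j \<in> verts Q \<Longrightarrow>
    gen (Vert i) * gen (Vert j) - (if i = j then gen (Vert i) else 0) \<in> lpa_rels Q"
| rel1_left: "a \<in> arcs Q \<Longrightarrow> gen (Vert (head Q a)) * gen (Arr a) - gen (Arr a) \<in> lpa_rels Q"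
| rel1_right: "a \<in> arcs Q \<Longrightarrow> gen (Arr a) * gen (Vert (tail Q a)) - gen (Arr a) \<in> lpa_rels Q"
| rel2_left: "a \<in> arcs Q \<Longrightarrow> gen (Vert (tail Q a)) * gen (Ghost a) - gen (Ghost a) \<in> lpa_rels Q"
| rel2_right: "a \<in> arcs Q \<Longrightarrow> gen (Ghost a) * gen (Vert (head Q a)) - gen (Ghost a) \<in> lpa_rels Q"
| rel3: "a \<in> arcs Q \<Longrightarrow> b \<in> arcs Q \<Longrightarrow>
    gen (Arr a) * gen (Ghost b) - (if a = b then gen (Vert (head Q a)) else 0) \<in> lpa_rels Q"
| rel4: "i \<in> regular_verts Q \<Longrightarrow>
    (\<Sum>a \<in> out_arcs Q i. gen (Ghost a) * gen (Arr a)) - gen (Vert i) \<in> lpa_rels Q"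

inductive_set lpa_ideal :: "('v, 'e) pre_digraph \<Rightarrow> ('v, 'e, 'k::field) lfree set"
  for Q :: "('v, 'e) pre_digraph" where
  zero: "0 \<in> lpa_ideal Q"
| rel: "r \<in> lpa_rels Q \<Longrightarrow> r \<in> lpa_ideal Q"
| add: "x \<in> lpa_ideal Q \<Longrightarrow> y \<in> lpa_ideal Q \<Longrightarrow> x + y \<in> lpa_ideal Q"
| scale: "x \<in> lpa_ideal Q \<Longrightarrow> pm_scale c x \<in> lpa_ideal Q"
| mult_left: "u \<in> lpa_free Q \<Longrightarrow> x \<in> lpa_ideal Q \<Longrightarrow> u * x \<in> lpa_ideal Q"
| mult_right: "u \<in> lpa_free Q \<Longrightarrow> x \<in> lpa_ideal Q \<Longrightarrow> x * u \<in> lpa_ideal Q"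

definition lpa_coset ::
  "('v, 'e) pre_digraph \<Rightarrow> ('v, 'e, 'k::field) lfree \<Rightarrow> ('v, 'e, 'k) lfree set" where
  "lpa_coset Q u = (+) u ` lpa_ideal Q"

definition lpa :: "('v, 'e) pre_digraph \<Rightarrow> ('k::field, ('v, 'e, 'k) lfree set) nalgebra" where
  "lpa Q =
     \<lparr> acarrier = lpa_coset Q ` lpa_free Q,
       aplus = (\<lambda>X Y. \<Union>x \<in> X. \<Union>y \<in> Y. lpa_coset Q (x + y)),
       amult = (\<lambda>X Y. \<Union>x \<in> X. \<Union>y \<in> Y. lpa_coset Q (x * y)),
       ascale = (\<lambda>c X. \<Union>x \<in> X. lpa_coset Q (pm_scale c x)) \<rparr>"

fun twist_gen :: "('e \<Rightarrow> 'k) \<Rightarrow> ('v, 'e) lgen \<Rightarrow> ('v, 'e, 'k::field) lfree" where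
  "twist_gen a (Vert i) = gen (Vert i)"
| "twist_gen a (Arr b) = pm_scale (a b) (gen (Arr b))"
| "twist_gen a (Ghost b) = pm_scale (inverse (a b)) (gen (Ghost b))"

text \<open>The automorphism \<open>\<gamma>_a\<close>; it is meaningful when \<open>a\<close> is nowhere zero on the arrows.\<close>

definition lpa_twist :: "('v, 'e) pre_digraph \<Rightarrow> ('e \<Rightarrow> 'k)
    \<Rightarrow> ('v, 'e, 'k::field) lfree set \<Rightarrow> ('v, 'e, 'k) lfree set" where
  "lpa_twist Q a X =
     (\<Union>x \<in> X. lpa_coset Q (lin_ext (\<lambda>w. prod_list (map (twist_gen a) w)) x))"


section \<open>Representations\<close>

text \<open>
  The underlying vector space of a representation is a subspace of an ambient vector space, whose
  addition is that of the type \<^typ>\<open>'m\<close>. Elements of the algebra (of type \<^typ>\<open>'x\<close>) act by \<open>ract\<close>,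
  whose values outside \<open>rspace\<close> are irrelevant.
\<close>

record ('k, 'x, 'm) repr =
  rspace :: "'m set"
  rscale :: "'k \<Rightarrow> 'm \<Rightarrow> 'm"
  ract :: "'x \<Rightarrow> 'm \<Rightarrow> 'm"

definition repr_hom :: "('k, 'x, 'm) repr \<Rightarrow> 'x \<Rightarrow> 'm \<Rightarrow> 'm" where
  "repr_hom M X = restrict (ract M X) (rspace M)"

definition is_repr ::
  "('k::field, 'x) nalgebra \<Rightarrow> ('k, 'x, 'm::ab_group_add) repr \<Rightarrow> bool" where
  "is_repr A M \<longleftrightarrow>
     vector_space (rscale M) \<and> module.subspace (rscale M) (rspace M) \<and>
     nalgebra_hom A (End_alg (rspace M) (rscale M)) (repr_hom M)"

definition faithful_repr ::
  "('k::field, 'x) nalgebra \<Rightarrow> ('k, 'x, 'm::ab_group_add) repr \<Rightarrow> bool" where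
  "faithful_repr A M \<longleftrightarrow> is_repr A M \<and> inj_on (repr_hom M) (acarrier A)"

definition direct_sum :: "'i set \<Rightarrow> ('i \<Rightarrow> ('k, 'x, 'm::zero) repr) \<Rightarrow> ('k, 'x, 'i \<Rightarrow>\<^sub>0 'm) repr" where
  "direct_sum I M =
     \<lparr> rspace = {f. Poly_Mapping.keys f \<subseteq> I \<and> (\<forall>i \<in> I. Poly_Mapping.lookup f i \<in> rspace (M i))},
       rscale = (\<lambda>c. Poly_Mapping.mapp (\<lambda>i. rscale (M i) c)),
       ract = (\<lambda>X. Poly_Mapping.mapp (\<lambda>i. ract (M i) X)) \<rparr>"

definition dsum2 :: "('k, 'x, 'm) repr \<Rightarrow> ('k, 'x, 'n) repr \<Rightarrow> ('k, 'x, 'm \<times> 'n) repr"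
    (infixr "\<oplus>" 65) where
  "M \<oplus> N =
     \<lparr> rspace = rspace M \<times> rspace N,
       rscale = (\<lambda>c. map_prod (rscale M c) (rscale N c)),
       ract = (\<lambda>X. map_prod (ract M X) (ract N X)) \<rparr>"

type_synonym ('v, 'e, 'k, 'm) lpa_repr = "('k, ('v, 'e, 'k) lfree set, 'm) repr"

text \<open>
  The representation on the vector space with basis \<open>B\<close> in which the generator \<open>g\<close> maps the basis
  vector \<open>b\<close> to \<open>T g b\<close>. As usual for maps defined on a quotient, \<^const>\<open>the_elem\<close> extracts the
  common action of all elements of a coset.
\<close>

definition gen_act :: "(('v, 'e) lgen \<Rightarrow> 'b \<Rightarrow> ('b \<Rightarrow>\<^sub>0 'k))
    \<Rightarrow> ('v, 'e, 'k::field) lfree \<Rightarrow> ('b \<Rightarrow>\<^sub>0 'k) \<Rightarrow> ('b \<Rightarrow>\<^sub>0 'k)" where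
  "gen_act T u f = lin_ext (\<lambda>w. foldr (\<lambda>g. lin_ext (T g)) w f) u"

definition basis_repr ::
  "'b set \<Rightarrow> (('v, 'e) lgen \<Rightarrow> 'b \<Rightarrow> ('b \<Rightarrow>\<^sub>0 'k)) \<Rightarrow> ('v, 'e, 'k::field, 'b \<Rightarrow>\<^sub>0 'k) lpa_repr" where
  "basis_repr B T =
     \<lparr> rspace = free_space B,
       rscale = pm_scale,
       ract = (\<lambda>X f. the_elem ((\<lambda>u. gen_act T u f) ` X)) \<rparr>"

fun F_gen :: "('v, 'e) pre_digraph \<Rightarrow> ('v, 'e) lgen \<Rightarrow> (nat \<Rightarrow> 'e)
    \<Rightarrow> ((nat \<Rightarrow> 'e) \<Rightarrow>\<^sub>0 'k::field)" where
  "F_gen Q (Vert i) p = (if i = tail Q (p 0) then basis_vec p else 0)"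
| "F_gen Q (Arr a) p = (if a = p 0 then basis_vec (tau 1 p) else 0)"
| "F_gen Q (Ghost a) p = (if head Q a = tail Q (p 0) then basis_vec (case_nat a p) else 0)"

definition F_repr :: "('v, 'e) pre_digraph \<Rightarrow> ('v, 'e, 'k::field, (nat \<Rightarrow> 'e) \<Rightarrow>\<^sub>0 'k) lpa_repr" where
  "F_repr Q = basis_repr (left_inf_paths Q) (F_gen Q)"

definition F_class :: "('v, 'e) pre_digraph \<Rightarrow> (nat \<Rightarrow> 'e) set
    \<Rightarrow> ('v, 'e, 'k::field, (nat \<Rightarrow> 'e) \<Rightarrow>\<^sub>0 'k) lpa_repr" where
  "F_class Q C = (F_repr Q)\<lparr> rspace := free_space C \<rparr>"

fun N_gen :: "('v, 'e) pre_digraph \<Rightarrow> ('v, 'e) lgen \<Rightarrow> 'v \<times> 'e list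
    \<Rightarrow> (('v \<times> 'e list) \<Rightarrow>\<^sub>0 'k::field)" where
  "N_gen Q (Vert i) (v, p) = (if i = v then basis_vec (v, p) else 0)"
| "N_gen Q (Arr a) (v, []) = 0"
| "N_gen Q (Arr a) (v, b # p) = (if a = b then basis_vec (head Q b, p) else 0)"
| "N_gen Q (Ghost a) (v, p) = (if head Q a = v then basis_vec (tail Q a, a # p) else 0)"

definition N_repr :: "('v, 'e) pre_digraph \<Rightarrow> ('v, 'e, 'k::field, ('v \<times> 'e list) \<Rightarrow>\<^sub>0 'k) lpa_repr" where
  "N_repr Q = basis_repr (\<Union>i \<in> sinks Q. paths_ending_at Q i) (N_gen Q)"

definition N_sink :: "('v, 'e) pre_digraph \<Rightarrow> 'v
    \<Rightarrow> ('v, 'e, 'k::field, ('v \<times> 'e list) \<Rightarrow>\<^sub>0 'k) lpa_repr" where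
  "N_sink Q i = (N_repr Q)\<lparr> rspace := free_space (paths_ending_at Q i) \<rparr>"

definition twisted :: "('v, 'e) pre_digraph \<Rightarrow> ('e \<Rightarrow> 'k) \<Rightarrow> ('v, 'e, 'k::field, 'm) lpa_repr
    \<Rightarrow> ('v, 'e, 'k, 'm) lpa_repr" where
  "twisted Q a M = M\<lparr> ract := (\<lambda>X. ract M (lpa_twist Q a X)) \<rparr>"

definition first_arrow_weight :: "'k \<Rightarrow> 'e list \<Rightarrow> 'e \<Rightarrow> 'k::one" where
  "first_arrow_weight c q = (\<lambda>a. if a = hd q then c else 1)"

end

theory Submission
  imports Defs "HOL-Computational_Algebra.Polynomial"
begin

text \<open>
  Relations (3) and (4) reduce injectivity to ghost paths. Relation (4), applied repeatedly, writes
  \<open>e_v\<close> as the sum of \<open>q\<^sup>* q\<close> over the paths \<open>q\<close> from \<open>v\<close> that have length \<open>n\<close>, or are shorter and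
  end at a sink; so \<open>u = 0\<close> as soon as all \<open>u q\<^sup>*\<close> vanish. For \<open>n\<close> large, relation (3) turns \<open>u q\<^sup>*\<close> into
  a linear combination \<open>y\<close> of ghost paths \<open>p\<^sup>*\<close> with \<open>t(p) = t(q) = t\<close>.

  If a path \<open>r\<close> leads from \<open>t\<close> to a sink, then \<open>y\<close> sends \<open>r\<close> to a combination of the distinct basis
  vectors \<open>r p\<close> of \<open>\<N>\<close>. Otherwise there is a left-infinite path \<open>r\<close> from \<open>t\<close>. Two of the paths \<open>r p\<close> can only
  coincide if \<open>r = d\<^sup>\<infinity>\<close> for a cycle \<open>d\<close>, which is impossible for irrational \<open>r\<close>. For rational \<open>r\<close>,
  the element \<open>p\<^sup>*\<close> acts on the twist by \<open>\<lambda>\<close> with the extra factor \<open>\<lambda>\<^bsup>-m\<^esup>\<close>, where \<open>m\<close> counts the twisted arrow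
  in \<open>p\<close>. As that arrow occurs in \<open>d\<close>, paths \<open>p\<close> with the same \<open>r p\<close> have different \<open>m\<close>, and a polynomial
  in \<open>\<lambda>\<^sup>-\<^sup>1\<close> with infinitely many roots is zero.
\<close>

section \<open>Linear maps between spaces of finitely supported functions\<close>

lemma lookup_pm_scale [simp]:
  "Poly_Mapping.lookup (pm_scale c f) x = c * Poly_Mapping.lookup f x"
  by (cases "Poly_Mapping.lookup f x = 0") (simp_all add: pm_scale_def Poly_Mapping.map.rep_eq)

lemma vector_space_pm_scale: "vector_space pm_scale"
  by unfold_locales (auto intro!: poly_mapping_eqI simp: lookup_add algebra_simps)

interpretation pm: vector_space pm_scale
  by (rule vector_space_pm_scale)

lemma subspace_free_space: "pm.subspace (free_space B :: ('b \<Rightarrow>\<^sub>0 'k::field) set)"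
proof (unfold pm.subspace_def free_space_def, safe)
  fix f g :: "'b \<Rightarrow>\<^sub>0 'k" and x
  assume "Poly_Mapping.keys f \<subseteq> B" "Poly_Mapping.keys g \<subseteq> B"
    and "x \<in> Poly_Mapping.keys (f + g)"
  then show "x \<in> B" using Poly_Mapping.keys_add [of f g] by blast
qed (auto simp: in_keys_iff)

lemmas free_space_zero [simp] = pm.subspace_0 [OF subspace_free_space]
lemmas free_space_add = pm.subspace_add [OF subspace_free_space]
lemmas free_space_scale = pm.subspace_scale [OF subspace_free_space]

lemma basis_vec_in_free_space [simp]:
  "(basis_vec b :: 'b \<Rightarrow>\<^sub>0 'k::field) \<in> free_space B \<longleftrightarrow> b \<in> B"
  by (simp add: basis_vec_def free_space_def)

lemma lookup_basis_vec: "Poly_Mapping.lookup (basis_vec b) x = (1 when b = x)"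
  by (simp add: basis_vec_def lookup_single)

text \<open>A linear statement about a free space can thus be checked on basis vectors. The
  induction runs over a finite superset \<open>K\<close> of the support: subtracting the coefficient
  at \<open>b\<close> leaves a support inside the smaller set, whether or not \<open>b\<close> was a
  key of \<open>f\<close>.\<close>

lemma free_space_induct [consumes 1, case_names zero add]:
  assumes "f \<in> free_space B" and "P 0"
    and "\<And>b c f. b \<in> B \<Longrightarrow> f \<in> free_space B \<Longrightarrow> P f \<Longrightarrow> P (pm_scale c (basis_vec b) + f)"
  shows "P f"
proof -
  have "finite K \<Longrightarrow> K \<subseteq> B \<Longrightarrow> Poly_Mapping.keys f \<subseteq> K \<Longrightarrow> P f" for K f
  proof (induction K arbitrary: f rule: finite_induct)
    case empty
    then show ?case using assms(2) by simp
  next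
    case (insert b K)
    define g where "g = f - pm_scale (Poly_Mapping.lookup f b) (basis_vec b)"
    have "Poly_Mapping.lookup g b = 0"
      by (simp add: g_def lookup_minus lookup_basis_vec)
    moreover have "Poly_Mapping.lookup g x = Poly_Mapping.lookup f x" if "x \<noteq> b" for x
      using that by (simp add: g_def lookup_minus lookup_basis_vec)
    ultimately have "Poly_Mapping.keys g \<subseteq> K"
      using insert.prems(2) by (metis in_keys_iff insertE subsetD subsetI)
    then have "P (pm_scale (Poly_Mapping.lookup f b) (basis_vec b) + g)"
      using insert by (intro assms(3)) (auto simp: free_space_def)
    then show ?case by (simp add: g_def)
  qed
  from this [of "Poly_Mapping.keys f" f] show ?thesis using assms(1) by (simp add: free_space_def)
qed

lemma pm_induct [case_names zero add]:
  assumes "P 0" and "\<And>b c f. P f \<Longrightarrow> P (pm_scale c (basis_vec b) + f)"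
  shows "P f"
  using free_space_induct [of f UNIV P] assms by (simp add: free_space_def)

text \<open>Coefficients vanish off the support, so two functions with different supports can be
  summed over a common index set; additivity rests on this.\<close>

lemma lin_ext_superset:
  assumes "finite K" and "Poly_Mapping.keys f \<subseteq> K"
  shows "lin_ext g f = (\<Sum>b\<in>K. pm_scale (Poly_Mapping.lookup f b) (g b))"
  unfolding lin_ext_def using assms
  by (intro sum.mono_neutral_left) (auto simp: in_keys_iff)

lemma lin_ext_add: "lin_ext g (f + f') = lin_ext g f + lin_ext g f'"
proof -
  let ?K = "Poly_Mapping.keys f \<union> Poly_Mapping.keys f'"
  show ?thesis
    using Poly_Mapping.keys_add [of f f']
    by (simp add: lin_ext_superset [of ?K] lookup_add pm.scale_left_distrib sum.distrib)
qed

lemma lin_ext_scale: "lin_ext g (pm_scale c f) = pm_scale c (lin_ext g f)"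
proof -
  have "Poly_Mapping.keys (pm_scale c f) \<subseteq> Poly_Mapping.keys f"
    by (auto simp: in_keys_iff)
  then show ?thesis
    by (simp add: lin_ext_superset [of "Poly_Mapping.keys f"] pm.scale_sum_right)
qed

lemma linear_lin_ext: "Vector_Spaces.linear pm_scale pm_scale (lin_ext g)"
  by (simp add: Vector_Spaces.linear_iff vector_space_pm_scale lin_ext_add lin_ext_scale)

lemma lin_ext_basis_vec [simp]: "lin_ext g (basis_vec b) = g b"
  by (simp add: lin_ext_def basis_vec_def)

lemma lin_ext_zero [simp]: "lin_ext g 0 = 0"
  by (simp add: lin_ext_def)

lemma lin_ext_in_free_space:
  assumes "f \<in> free_space B" and "\<And>b. b \<in> B \<Longrightarrow> g b \<in> free_space B'"
  shows "lin_ext g f \<in> free_space B'"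
  using assms(1)
proof (induction rule: free_space_induct)
  case zero
  then show ?case by simp
next
  case (add b c f)
  have "lin_ext g (pm_scale c (basis_vec b)) \<in> free_space B'"
    unfolding lin_ext_scale lin_ext_basis_vec by (intro free_space_scale assms(2) add)
  then show ?case
    unfolding lin_ext_add using add by (intro free_space_add) simp_all
qed

section \<open>Scalars and words in the free algebra\<close>

lemma pm_scale_single: "pm_scale c (Poly_Mapping.single b d) = Poly_Mapping.single b (c * d)"
  by (rule poly_mapping_eqI) (simp add: lookup_single when_def)

lemma pm_scale_eq_mult: "pm_scale c f = Poly_Mapping.single 0 c * f"
  for f :: "'b::monoid_add \<Rightarrow>\<^sub>0 'k::field"
proof (induction f rule: pm_induct)
  case zero
  then show ?case by simp
next
  case (add b d f)
  have "pm_scale c (pm_scale d (basis_vec b)) = Poly_Mapping.single 0 c * pm_scale d (basis_vec b)"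
    by (simp add: basis_vec_def pm_scale_single mult_single mult.commute mult.left_commute)
  then show ?case using add by (simp add: pm.scale_right_distrib distrib_left)
qed

lemma pm_scale_mult_left: "pm_scale c f * g = pm_scale c (f * g)"
  for f :: "'b::monoid_add \<Rightarrow>\<^sub>0 'k::field"
  by (simp add: pm_scale_eq_mult mult.assoc)

text \<open>Scalars are central although the monoid of words is not commutative. Associativity does
  not give this; it is checked on basis vectors in both factors.\<close>

lemma pm_scale_mult_right: "f * pm_scale c g = pm_scale c (f * g)"
  for f :: "'b::monoid_add \<Rightarrow>\<^sub>0 'k::field"
proof (induction f rule: pm_induct)
  case zero
  then show ?case by simp
next
  case (add b d f)
  have "basis_vec b * pm_scale c g = pm_scale c (basis_vec b * g)"
  proof (induction g rule: pm_induct)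
    case zero
    then show ?case by simp
  next
    case (add b' d' g)
    have "basis_vec b * pm_scale c (pm_scale d' (basis_vec b'))
      = pm_scale c (basis_vec b * pm_scale d' (basis_vec b'))"
      by (simp add: basis_vec_def pm_scale_single mult_single mult.commute mult.left_commute)
    then show ?case using add by (simp add: pm.scale_right_distrib distrib_left)
  qed
  then have "pm_scale d (basis_vec b) * pm_scale c g = pm_scale c (pm_scale d (basis_vec b) * g)"
    by (simp only: pm_scale_mult_left pm.scale_left_commute)
  with add show ?case
    unfolding distrib_right pm.scale_right_distrib by (rule arg_cong2 [of _ _ _ _ "(+)", rotated])
qed

lemma basis_vec_mult: "(basis_vec w * basis_vec w' :: 'g list \<Rightarrow>\<^sub>0 'k::field) = basis_vec (w @ w')"
  unfolding basis_vec_def mult_single plus_list_def by simp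

lemma basis_vec_Nil: "(basis_vec [] :: 'g list \<Rightarrow>\<^sub>0 'k::field) = 1"
  unfolding basis_vec_def zero_list_def [symmetric] by (rule single_one)

section \<open>Sums of representations\<close>

text \<open>The pointwise content of a homomorphism into \<open>End_alg\<close>, free of functions
  that are undefined off \<open>V\<close>: the first three conjuncts make each \<open>h X\<close> an
  endomorphism, the last three make \<open>h\<close> compatible with the operations of the
  algebra.\<close>

definition acts_on ::
  "('k::field, 'x) nalgebra \<Rightarrow> 'm::ab_group_add set \<Rightarrow> ('k \<Rightarrow> 'm \<Rightarrow> 'm) \<Rightarrow> ('x \<Rightarrow> 'm \<Rightarrow> 'm) \<Rightarrow> bool" where
  "acts_on A V s h \<longleftrightarrow>
     (\<forall>X\<in>acarrier A. \<forall>v\<in>V. h X v \<in> V) \<and>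
     (\<forall>X\<in>acarrier A. \<forall>v\<in>V. \<forall>w\<in>V. h X (v + w) = h X v + h X w) \<and>
     (\<forall>X\<in>acarrier A. \<forall>c. \<forall>v\<in>V. h X (s c v) = s c (h X v)) \<and>
     (\<forall>X\<in>acarrier A. \<forall>Y\<in>acarrier A. \<forall>v\<in>V. h (aplus A X Y) v = h X v + h Y v) \<and>
     (\<forall>X\<in>acarrier A. \<forall>Y\<in>acarrier A. \<forall>v\<in>V. h (amult A X Y) v = h X (h Y v)) \<and>
     (\<forall>c. \<forall>X\<in>acarrier A. \<forall>v\<in>V. h (ascale A c X) v = s c (h X v))"

lemma restrict_eq_iff: "restrict f V = restrict g V \<longleftrightarrow> (\<forall>v\<in>V. f v = g v)"
  by (metis restrict_apply' restrict_ext)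

text \<open>Closure of \<open>V\<close> under sums and scalars ensures that a restricted function,
  evaluated at \<open>v + w\<close> or \<open>s c v\<close>, still agrees with the original
  one.\<close>

lemma nalgebra_hom_End_alg_iff:
  assumes "\<And>v w. v \<in> V \<Longrightarrow> w \<in> V \<Longrightarrow> v + w \<in> V" "\<And>c v. v \<in> V \<Longrightarrow> s c v \<in> V"
  shows "nalgebra_hom A (End_alg V s) (\<lambda>X. restrict (h X) V) \<longleftrightarrow> acts_on A V s h"
proof -
  have mem: "restrict f V \<in> acarrier (End_alg V s) \<longleftrightarrow>
      (\<forall>v\<in>V. f v \<in> V) \<and> (\<forall>v\<in>V. \<forall>w\<in>V. f (v + w) = f v + f w) \<and>
      (\<forall>c. \<forall>v\<in>V. f (s c v) = s c (f v))" for f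
    using assms by (auto simp: End_alg_def restrict_PiE_iff)
  have plus: "restrict f V = aplus (End_alg V s) (restrict g V) (restrict g' V) \<longleftrightarrow>
      (\<forall>v\<in>V. f v = g v + g' v)" for f g g'
    by (simp add: End_alg_def restrict_eq_iff)
  have mult: "restrict f V = amult (End_alg V s) (restrict g V) (restrict g' V) \<longleftrightarrow>
      (\<forall>v\<in>V. f v = g (g' v))" if "\<forall>v\<in>V. g' v \<in> V" for f g g'
    using that by (simp add: End_alg_def compose_def restrict_eq_iff)
  have scale: "restrict f V = ascale (End_alg V s) c (restrict g V) \<longleftrightarrow>
      (\<forall>v\<in>V. f v = s c (g v))" for f g c
    by (simp add: End_alg_def restrict_eq_iff)
  show ?thesis
    unfolding nalgebra_hom_def acts_on_def Pi_iff mem plus scale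
    by (auto simp: mult)
qed

lemma is_repr_iff:
  "is_repr A M \<longleftrightarrow> vector_space (rscale M) \<and> module.subspace (rscale M) (rspace M) \<and>
     acts_on A (rspace M) (rscale M) (ract M)"
proof -
  have "nalgebra_hom A (End_alg (rspace M) (rscale M)) (repr_hom M) \<longleftrightarrow>
      acts_on A (rspace M) (rscale M) (ract M)"
    if "vector_space (rscale M)" "module.subspace (rscale M) (rspace M)"
  proof -
    interpret vector_space "rscale M" by fact
    show ?thesis
      unfolding repr_hom_def
      using that by (intro nalgebra_hom_End_alg_iff) (auto intro: subspace_add subspace_scale)
  qed
  then show ?thesis by (auto simp: is_repr_def)
qed

lemma is_repr_dsum2:
  assumes M: "is_repr A M" and N: "is_repr A N"
  shows "is_repr A (M \<oplus> N)"
proof -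
  interpret m: vector_space "rscale M" using M by (simp add: is_repr_iff)
  interpret n: vector_space "rscale N" using N by (simp add: is_repr_iff)
  interpret mn: vector_space "\<lambda>c. map_prod (rscale M c) (rscale N c)"
    by unfold_locales (auto simp: m.scale_right_distrib n.scale_right_distrib
        m.scale_left_distrib n.scale_left_distrib)
  have "mn.subspace (rspace M \<times> rspace N)"
    using M N unfolding is_repr_iff mn.subspace_def m.subspace_def n.subspace_def
    by (auto simp: zero_prod_def)
  moreover have "acts_on A (rspace (M \<oplus> N)) (rscale (M \<oplus> N)) (ract (M \<oplus> N))"
    using M N unfolding is_repr_iff acts_on_def dsum2_def by simp
  ultimately show ?thesis
    by (simp add: is_repr_iff dsum2_def mn.vector_space_axioms)
qed

text \<open>\<open>mapp\<close> applies \<open>f\<close> only on the support and leaves 0 elsewhere,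
  hence the condition at 0. It is also why the action of each algebra element on 0 has to be
  controlled in direct sums.\<close>

lemma lookup_mapp_zero:
  assumes "f k 0 = 0"
  shows "Poly_Mapping.lookup (Poly_Mapping.mapp f p) k = f k (Poly_Mapping.lookup p k)"
  using assms by (simp add: lookup_mapp when_def in_keys_iff)

lemma is_repr_zero:
  assumes "is_repr A M"
  shows "0 \<in> rspace M" and "X \<in> acarrier A \<Longrightarrow> ract M X 0 = 0"
proof -
  interpret m: vector_space "rscale M" using assms by (simp add: is_repr_iff)
  show *: "0 \<in> rspace M"
    using assms m.subspace_0 by (simp add: is_repr_iff)
  show "ract M X 0 = 0" if "X \<in> acarrier A"
  proof -
    have "ract M X (0 + 0) = ract M X 0 + ract M X 0"
      using assms * that unfolding is_repr_iff acts_on_def by blast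
    then show ?thesis by simp
  qed
qed

lemma lookup_ract_direct_sum:
  assumes "\<And>i. i \<in> I \<Longrightarrow> ract (M i) X 0 = 0" and "f \<in> rspace (direct_sum I M)"
  shows "Poly_Mapping.lookup (ract (direct_sum I M) X f) i =
    (if i \<in> I then ract (M i) X (Poly_Mapping.lookup f i) else 0)"
proof (cases "i \<in> I")
  case True
  then show ?thesis
    by (simp add: direct_sum_def lookup_mapp_zero assms(1))
next
  case False
  then have "i \<notin> Poly_Mapping.keys f"
    using assms(2) by (auto simp: direct_sum_def)
  with False show ?thesis
    by (simp add: direct_sum_def lookup_mapp)
qed

text \<open>The vector space axioms are demanded at every index, since the scalar multiplication of
  the ambient space does not see \<open>I\<close>; the actions are controlled on \<open>I\<close>
  only.\<close>

lemma is_repr_direct_sum: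
  assumes vs: "\<And>i. vector_space (rscale (M i))" and repr: "\<And>i. i \<in> I \<Longrightarrow> is_repr A (M i)"
  shows "is_repr A (direct_sum I M)"
proof -
  let ?S = "direct_sum I M"
  interpret mi: vector_space "rscale (M i)" for i by (rule vs)
  have lookup_scale: "Poly_Mapping.lookup (rscale ?S c f) i = rscale (M i) c (Poly_Mapping.lookup f i)" for c f i
    by (simp add: direct_sum_def lookup_mapp_zero)
  interpret ds: vector_space "rscale ?S"
    by unfold_locales (auto intro!: poly_mapping_eqI simp: lookup_add lookup_scale
        mi.scale_right_distrib mi.scale_left_distrib)
  \<comment> \<open>Putting the zero subspace at the indices outside \<open>I\<close> turns the
    support condition into one membership at each index.\<close>
  have mem: "f \<in> rspace ?S \<longleftrightarrow> (\<forall>i. Poly_Mapping.lookup f i \<in> (if i \<in> I then rspace (M i) else {0}))" for f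
    by (auto simp: direct_sum_def in_keys_iff)
  have sub: "mi.subspace i (if i \<in> I then rspace (M i) else {0})" for i
    using repr by (simp add: is_repr_iff mi.subspace_def)
  have subspace: "ds.subspace (rspace ?S)"
    unfolding ds.subspace_def
  proof (intro conjI ballI allI)
    show "0 \<in> rspace ?S"
      unfolding mem lookup_zero by (intro allI mi.subspace_0 [OF sub])
  next
    fix f g assume "f \<in> rspace ?S" "g \<in> rspace ?S"
    then show "f + g \<in> rspace ?S"
      unfolding mem lookup_add by (intro allI mi.subspace_add [OF sub]) iprover+
  next
    fix c f assume "f \<in> rspace ?S"
    then show "rscale ?S c f \<in> rspace ?S"
      unfolding mem lookup_scale by (intro allI mi.subspace_scale [OF sub]) iprover
  qed
  have acts: "acts_on A (rspace (M i)) (rscale (M i)) (ract (M i))" if "i \<in> I" for i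
    using repr [OF that] by (simp add: is_repr_iff)
  have comp: "Poly_Mapping.lookup f i \<in> rspace (M i)" if "f \<in> rspace ?S" "i \<in> I" for f i
    using that by (simp add: direct_sum_def)
  note act = lookup_ract_direct_sum [of I M]
  note zero = is_repr_zero [OF repr]
  have closed: "ract ?S X f \<in> rspace ?S" if "X \<in> acarrier A" "f \<in> rspace ?S" for X f
    unfolding mem using acts comp that by (auto simp: act zero acts_on_def)
  have "acts_on A (rspace ?S) (rscale ?S) (ract ?S)"
    unfolding acts_on_def
  proof (intro conjI ballI allI poly_mapping_eqI)
    fix X f assume Xf: "X \<in> acarrier A" "f \<in> rspace ?S"
    show "ract ?S X f \<in> rspace ?S" by (rule closed [OF Xf])
    fix i c
    have "rscale ?S c f \<in> rspace ?S"
      using Xf by (intro ds.subspace_scale subspace)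
    then show "Poly_Mapping.lookup (ract ?S X (rscale ?S c f)) i
        = Poly_Mapping.lookup (rscale ?S c (ract ?S X f)) i"
      using acts [of i] comp [of f i] Xf by (auto simp: act zero lookup_scale acts_on_def)
    show "Poly_Mapping.lookup (ract ?S (ascale A c X) f) i
        = Poly_Mapping.lookup (rscale ?S c (ract ?S X f)) i"
    proof (subst act)
      \<comment> \<open>\<open>A\<close> is an arbitrary structure, not known to be closed under its
        operations, so the value at 0 is computed from the action of \<open>X\<close>.\<close>
      show "ract (M j) (ascale A c X) 0 = 0" if "j \<in> I" for j
        using acts [OF that] zero [OF that] Xf by (simp add: acts_on_def)
    qed (use acts [of i] comp [of f i] Xf in \<open>auto simp: act zero lookup_scale acts_on_def\<close>)
  next
    fix X f g i assume Xf: "X \<in> acarrier A" "f \<in> rspace ?S" "g \<in> rspace ?S"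
    then have "f + g \<in> rspace ?S" by (intro ds.subspace_add subspace)
    then show "Poly_Mapping.lookup (ract ?S X (f + g)) i
        = Poly_Mapping.lookup (ract ?S X f + ract ?S X g) i"
      using acts [of i] comp [of f i] comp [of g i] Xf by (auto simp: act zero lookup_add acts_on_def)
  next
    fix X Y f i assume Xf: "X \<in> acarrier A" "Y \<in> acarrier A" "f \<in> rspace ?S"
    show "Poly_Mapping.lookup (ract ?S (aplus A X Y) f) i
        = Poly_Mapping.lookup (ract ?S X f + ract ?S Y f) i"
    proof (subst act)
      show "ract (M j) (aplus A X Y) 0 = 0" if "j \<in> I" for j
        using acts [OF that] zero [OF that] Xf by (simp add: acts_on_def)
    qed (use acts [of i] comp [of f i] Xf in \<open>auto simp: act zero lookup_add acts_on_def\<close>)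
    have Yf: "ract ?S Y f \<in> rspace ?S" using Xf by (intro closed)
    show "Poly_Mapping.lookup (ract ?S (amult A X Y) f) i
        = Poly_Mapping.lookup (ract ?S X (ract ?S Y f)) i"
    proof (subst act)
      show "ract (M j) (amult A X Y) 0 = 0" if "j \<in> I" for j
        using acts [OF that] zero [OF that] Xf by (simp add: acts_on_def)
    qed (use acts [of i] comp [of f i] Xf Yf in \<open>auto simp: act zero acts_on_def\<close>)
  qed
  then show ?thesis
    by (simp add: is_repr_iff ds.vector_space_axioms subspace)
qed

text \<open>Equal actions on the sum are tested on vectors concentrated in a single summand.\<close>

lemma repr_hom_direct_sum_eqD:
  assumes eq: "repr_hom (direct_sum I M) X = repr_hom (direct_sum I M) Y"
    and repr: "\<And>i. i \<in> I \<Longrightarrow> is_repr A (M i)" and XY: "X \<in> acarrier A" "Y \<in> acarrier A"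
    and i: "i \<in> I" and v: "v \<in> rspace (M i)"
  shows "ract (M i) X v = ract (M i) Y v"
proof -
  let ?f = "Poly_Mapping.single i v"
  have f: "?f \<in> rspace (direct_sum I M)"
    using i v is_repr_zero(1) [OF repr] by (auto simp: direct_sum_def lookup_single when_def)
  have "ract (direct_sum I M) X ?f = ract (direct_sum I M) Y ?f"
    using eq f unfolding repr_hom_def restrict_eq_iff by blast
  then have "Poly_Mapping.lookup (ract (direct_sum I M) X ?f) i
      = Poly_Mapping.lookup (ract (direct_sum I M) Y ?f) i" by simp
  then show ?thesis
    using f i XY is_repr_zero(2) [OF repr] by (simp add: lookup_ract_direct_sum)
qed

lemma repr_hom_dsum2_eqD:
  assumes "repr_hom (M \<oplus> N) X = repr_hom (M \<oplus> N) Y"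
    and "is_repr A M" "is_repr A N"
  shows "repr_hom M X = repr_hom M Y" and "repr_hom N X = repr_hom N Y"
  using assms(1) is_repr_zero(1) [OF assms(2)] is_repr_zero(1) [OF assms(3)]
  unfolding repr_hom_def restrict_eq_iff dsum2_def by auto

section \<open>The action of the free algebra\<close>

lemma gen_act_basis_vec: "gen_act T (basis_vec w) f = foldr (\<lambda>g. lin_ext (T g)) w f"
  by (simp add: gen_act_def)

abbreviation pm_linear :: "(('b \<Rightarrow>\<^sub>0 'k::field) \<Rightarrow> ('c \<Rightarrow>\<^sub>0 'k)) \<Rightarrow> bool" where
  "pm_linear \<equiv> Vector_Spaces.linear pm_scale pm_scale"

lemma pm_linearI:
  assumes "\<And>x y. h (x + y) = h x + h y" "\<And>c x. h (pm_scale c x) = pm_scale c (h x)"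
  shows "pm_linear h"
  using assms by (simp add: Vector_Spaces.linear_iff vector_space_pm_scale)

lemma
  assumes "pm_linear h"
  shows pm_linear_add: "h (x + y) = h x + h y"
    and pm_linear_scale: "h (pm_scale c x) = pm_scale c (h x)"
    and pm_linear_zero: "h 0 = 0"
    and pm_linear_diff: "h (x - y) = h x - h y"
    and pm_linear_sum: "h (sum F S) = (\<Sum>x\<in>S. h (F x))"
proof -
  interpret Vector_Spaces.linear pm_scale pm_scale h by fact
  show "h (x + y) = h x + h y" by (rule add)
  show "h (pm_scale c x) = pm_scale c (h x)" by (rule scale)
  show "h 0 = 0" by (rule zero)
  show "h (x - y) = h x - h y" by (rule diff)
  show "h (sum F S) = (\<Sum>x\<in>S. h (F x))" by (rule sum)
qed

lemma pm_linear_eq_0: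
  assumes "pm_linear h"
    and "f \<in> free_space B" and "\<And>b. b \<in> B \<Longrightarrow> h (basis_vec b) = 0"
  shows "h f = 0"
  using assms(2) by (induction rule: free_space_induct)
    (simp_all only: pm_linear_add [OF assms(1)] pm_linear_scale [OF assms(1)]
      pm_linear_zero [OF assms(1)] assms(3) pm.scale_zero_right add_0)

lemma pm_linear_eq:
  assumes "pm_linear h" "pm_linear h'" and "\<And>b. h (basis_vec b) = h' (basis_vec b)"
  shows "h f = h' f"
proof (induction f rule: pm_induct)
  case zero
  then show ?case by (simp only: pm_linear_zero assms)
next
  case (add b c f)
  then show ?case by (simp only: pm_linear_add pm_linear_scale assms)
qed

lemma pm_linear_comp: "pm_linear g \<Longrightarrow> pm_linear h \<Longrightarrow> pm_linear (\<lambda>x. g (h x))"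
  by (intro pm_linearI) (simp_all only: pm_linear_add pm_linear_scale)

lemma pm_linear_mult_left: "pm_linear (\<lambda>x. u * x)" and pm_linear_mult_right: "pm_linear (\<lambda>x. x * u)"
  for u :: "'b::monoid_add \<Rightarrow>\<^sub>0 'k::field"
  by (intro pm_linearI distrib_left distrib_right pm_scale_mult_left pm_scale_mult_right)+

lemma pm_linear_gen_act_left: "pm_linear (\<lambda>u. gen_act T u f)"
  unfolding gen_act_def by (rule linear_lin_ext)

lemma pm_linear_foldr: "(\<And>g. pm_linear (T g)) \<Longrightarrow> pm_linear (foldr T w)"
  by (induction w) (auto intro: pm_linearI simp: pm_linear_add pm_linear_scale)

lemma pm_linear_gen_act_right: "pm_linear (gen_act T u)"
proof (rule pm_linearI)
  have lin: "pm_linear (foldr (\<lambda>g. lin_ext (T g)) w)" for w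
    by (intro pm_linear_foldr linear_lin_ext)
  note [simp] = pm_linear_add [OF lin] pm_linear_scale [OF lin]
  show "gen_act T u (x + y) = gen_act T u x + gen_act T u y" for x y
    by (simp add: gen_act_def lin_ext_def pm.scale_right_distrib sum.distrib)
  show "gen_act T u (pm_scale c x) = pm_scale c (gen_act T u x)" for c x
    by (simp add: gen_act_def lin_ext_def pm.scale_sum_right mult.commute)
qed

text \<open>Both sides are bilinear in \<open>u\<close> and \<open>v\<close>. On two words the claim
  says that folding over a concatenation is the composite of the folds.\<close>

lemma gen_act_mult: "gen_act T (u * v) f = gen_act T u (gen_act T v f)"
proof (rule pm_linear_eq [of "\<lambda>u. gen_act T (u * v) f" "\<lambda>u. gen_act T u (gen_act T v f)"])
  fix w
  show "gen_act T (basis_vec w * v) f = gen_act T (basis_vec w) (gen_act T v f)"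
  proof (rule pm_linear_eq [of "\<lambda>v. gen_act T (basis_vec w * v) f" "\<lambda>v. gen_act T (basis_vec w) (gen_act T v f)"])
    show "pm_linear (\<lambda>v. gen_act T (basis_vec w * v) f)"
      by (rule pm_linear_comp [OF pm_linear_gen_act_left pm_linear_mult_left])
    show "pm_linear (\<lambda>v. gen_act T (basis_vec w) (gen_act T v f))"
      by (rule pm_linear_comp [OF pm_linear_gen_act_right pm_linear_gen_act_left])
  qed (simp add: basis_vec_mult gen_act_basis_vec)
qed (rule pm_linear_comp [OF pm_linear_gen_act_left pm_linear_mult_right] pm_linear_gen_act_left)+

lemma gen_act_gen: "gen_act T (gen g) f = lin_ext (T g) f"
  by (simp add: gen_def gen_act_basis_vec)

lemma gen_act_in_free_space:
  assumes "u \<in> lpa_free Q" and "f \<in> free_space B"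
    and "\<And>g b. g \<in> lgens Q \<Longrightarrow> b \<in> B \<Longrightarrow> T g b \<in> free_space B"
  shows "gen_act T u f \<in> free_space B"
  unfolding gen_act_def
proof (rule lin_ext_in_free_space)
  show "u \<in> free_space (lists (lgens Q) - {[]})"
    using assms(1) by (simp add: lpa_free_def free_nalg_def)
  fix w assume "w \<in> lists (lgens Q) - {[]}"
  then have "set w \<subseteq> lgens Q" by auto
  then show "foldr (\<lambda>g. lin_ext (T g)) w f \<in> free_space B"
    by (induction w) (auto intro!: lin_ext_in_free_space assms)
qed

section \<open>The ideal of relations and the twisting automorphisms\<close>

lemma subspace_lpa_ideal: "pm.subspace (lpa_ideal Q)"
  by (auto simp: pm.subspace_def intro: lpa_ideal.intros)

lemmas lpa_ideal_sum = pm.subspace_sum [OF subspace_lpa_ideal]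

lemma subspace_lpa_free: "pm.subspace (lpa_free Q)"
  unfolding lpa_free_def free_nalg_def by (rule subspace_free_space)

lemmas lpa_free_zero = pm.subspace_0 [OF subspace_lpa_free]
lemmas lpa_free_add = pm.subspace_add [OF subspace_lpa_free]
lemmas lpa_free_diff = pm.subspace_diff [OF subspace_lpa_free]
lemmas lpa_free_scale = pm.subspace_scale [OF subspace_lpa_free]
lemmas lpa_free_sum = pm.subspace_sum [OF subspace_lpa_free]

lemma basis_vec_in_lpa_free [simp]:
  "(basis_vec w :: ('v, 'e, 'k::field) lfree) \<in> lpa_free Q \<longleftrightarrow> w \<noteq> [] \<and> set w \<subseteq> lgens Q"
  by (auto simp: lpa_free_def free_nalg_def in_lists_conv_set)

lemma lpa_free_induct [consumes 1, case_names zero add]: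
  fixes x :: "('v, 'e, 'k::field) lfree"
  assumes "x \<in> lpa_free Q" and "P 0"
    and "\<And>w c f. w \<noteq> [] \<Longrightarrow> set w \<subseteq> lgens Q \<Longrightarrow> f \<in> lpa_free Q \<Longrightarrow> P f \<Longrightarrow> P (pm_scale c (basis_vec w) + f)"
  shows "P x"
  using assms(1) unfolding lpa_free_def free_nalg_def
  by (induction rule: free_space_induct)
    (use assms(2,3) in \<open>auto simp: lpa_free_def free_nalg_def in_lists_conv_set subset_iff\<close>)

lemma lpa_free_mult:
  fixes x y :: "('v, 'e, 'k::field) lfree"
  assumes "x \<in> lpa_free Q" "y \<in> lpa_free Q"
  shows "x * y \<in> lpa_free Q"
  using assms(1)
proof (induction rule: lpa_free_induct)
  case zero
  then show ?case by (simp add: lpa_free_zero)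
next
  case (add w c f)
  have "basis_vec w * y \<in> lpa_free Q"
    using assms(2)
  proof (induction rule: lpa_free_induct)
    case zero
    then show ?case by (simp add: lpa_free_zero)
  next
    case (add w' c' f')
    have "basis_vec (w @ w') \<in> (lpa_free Q :: ('v, 'e, 'k) lfree set)"
      using add \<open>w \<noteq> []\<close> \<open>set w \<subseteq> lgens Q\<close> by simp
    with add show ?case
      unfolding distrib_left pm_scale_mult_right basis_vec_mult
      by (intro lpa_free_add lpa_free_scale)
  qed
  with add show ?case
    unfolding distrib_right pm_scale_mult_left by (intro lpa_free_add lpa_free_scale)
qed

lemma gen_in_lpa_free [simp]:
  "(gen g :: ('v, 'e, 'k::field) lfree) \<in> lpa_free Q \<longleftrightarrow> g \<in> lgens Q"
  by (simp add: gen_def)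

lemma in_lgens [simp]:
  "Vert v \<in> lgens Q \<longleftrightarrow> v \<in> verts Q"
  "Arr a \<in> lgens Q \<longleftrightarrow> a \<in> arcs Q"
  "Ghost a \<in> lgens Q \<longleftrightarrow> a \<in> arcs Q"
  by (auto simp: lgens_def)

lemma lpa_coset_eq_iff: "lpa_coset Q x = lpa_coset Q y \<longleftrightarrow> x - y \<in> lpa_ideal Q"
proof
  assume "lpa_coset Q x = lpa_coset Q y"
  moreover have "x \<in> lpa_coset Q x"
    unfolding lpa_coset_def by (rule image_eqI [of _ _ 0]) (simp_all add: lpa_ideal.zero)
  ultimately show "x - y \<in> lpa_ideal Q" by (auto simp: lpa_coset_def)
next
  have "lpa_coset Q x \<subseteq> lpa_coset Q y" if "x - y \<in> lpa_ideal Q" for x y :: "('a, 'b, 'c) lfree"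
  proof
    fix z assume "z \<in> lpa_coset Q x"
    then obtain r where "r \<in> lpa_ideal Q" "z = y + ((x - y) + r)" by (auto simp: lpa_coset_def)
    then show "z \<in> lpa_coset Q y"
      using that unfolding lpa_coset_def by (blast intro: lpa_ideal.add)
  qed
  moreover assume "x - y \<in> lpa_ideal Q"
  \<comment> \<open>The rules generating the ideal include no negation; scaling by -1 replaces
    it.\<close>
  moreover from this have "y - x \<in> lpa_ideal Q"
    using lpa_ideal.scale [of "x - y" Q "-1"] by (simp add: pm.scale_minus_left)
  ultimately show "lpa_coset Q x = lpa_coset Q y" by blast
qed

lemma mem_lpa_coset_iff: "z \<in> lpa_coset Q x \<longleftrightarrow> z - x \<in> lpa_ideal Q"
  by (force simp: lpa_coset_def image_iff algebra_simps)

lemma mem_lpa_coset_self: "x \<in> lpa_coset Q x"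
  by (simp add: mem_lpa_coset_iff lpa_ideal.zero)

text \<open>The operations of \<open>lpa\<close> are unions over all representatives. If
  \<open>h\<close> respects congruence modulo the ideal, all members of the union coincide.\<close>

lemma UN_lpa_coset:
  assumes "\<And>x'. x' - x \<in> lpa_ideal Q \<Longrightarrow> h x' - h x \<in> lpa_ideal Q"
  shows "(\<Union>x'\<in>lpa_coset Q x. lpa_coset Q (h x')) = lpa_coset Q (h x)"
proof -
  have "lpa_coset Q (h x') = lpa_coset Q (h x)" if "x' \<in> lpa_coset Q x" for x'
    using that assms by (simp add: mem_lpa_coset_iff lpa_coset_eq_iff)
  then show ?thesis using mem_lpa_coset_self [of x Q] by blast
qed

section \<open>Twisting on the free algebra and its descent to cosets\<close>

definition free_twist :: "('e \<Rightarrow> 'k) \<Rightarrow> ('v, 'e, 'k::field) lfree \<Rightarrow> ('v, 'e, 'k) lfree" where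
  "free_twist a = lin_ext (\<lambda>w. prod_list (map (twist_gen a) w))"

fun gen_weight :: "('e \<Rightarrow> 'k) \<Rightarrow> ('v, 'e) lgen \<Rightarrow> 'k::field" where
  "gen_weight a (Vert i) = 1"
| "gen_weight a (Arr b) = a b"
| "gen_weight a (Ghost b) = inverse (a b)"

lemma pm_linear_free_twist: "pm_linear (free_twist a)"
  unfolding free_twist_def by (rule linear_lin_ext)

text \<open>Twisting multiplies each generator by a scalar, so words are eigenvectors; later the
  eigenvalues of ghost paths supply the powers of \<lambda>.\<close>

lemma free_twist_basis_vec:
  "free_twist a (basis_vec w) = pm_scale (prod_list (map (gen_weight a) w)) (basis_vec w)"
proof -
  have gen: "twist_gen a g = pm_scale (gen_weight a g) (gen g)" for g :: "('a, 'b) lgen"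
    by (cases g) simp_all
  have "prod_list (map (twist_gen a) w) = pm_scale (prod_list (map (gen_weight a) w)) (basis_vec w)"
  proof (induction w)
    case Nil
    then show ?case by (simp add: basis_vec_Nil)
  next
    case (Cons g w)
    then show ?case
      by (simp only: list.map prod_list.Cons gen gen_def pm_scale_mult_left pm_scale_mult_right
          basis_vec_mult append_Cons append_Nil pm.scale_scale mult.commute)
  qed
  then show ?thesis by (simp add: free_twist_def)
qed

lemma free_twist_mult: "free_twist a (x * y) = free_twist a x * free_twist a y"
proof (rule pm_linear_eq [of "\<lambda>x. free_twist a (x * y)" "\<lambda>x. free_twist a x * free_twist a y"])
  fix w
  show "free_twist a (basis_vec w * y) = free_twist a (basis_vec w) * free_twist a y"
  proof (rule pm_linear_eq [of "\<lambda>y. free_twist a (basis_vec w * y)" "\<lambda>y. free_twist a (basis_vec w) * free_twist a y"])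
    show "free_twist a (basis_vec w * basis_vec w') = free_twist a (basis_vec w) * free_twist a (basis_vec w')" for w'
      by (simp only: basis_vec_mult free_twist_basis_vec pm_scale_mult_left pm_scale_mult_right
          map_append prod_list.append pm.scale_scale mult.commute)
  qed (rule pm_linear_comp [OF pm_linear_mult_left pm_linear_free_twist]
      pm_linear_comp [OF pm_linear_free_twist pm_linear_mult_left])+
qed (rule pm_linear_comp [OF pm_linear_mult_right pm_linear_free_twist]
    pm_linear_comp [OF pm_linear_free_twist pm_linear_mult_right])+

lemma free_twist_in_lpa_free:
  assumes "x \<in> lpa_free Q"
  shows "free_twist a x \<in> lpa_free Q"
  using assms
proof (induction rule: lpa_free_induct)
  case zero
  then show ?case by (simp add: pm_linear_zero [OF pm_linear_free_twist] lpa_free_zero)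
next
  case (add w c f)
  then show ?case
    unfolding pm_linear_add [OF pm_linear_free_twist] pm_linear_scale [OF pm_linear_free_twist]
      free_twist_basis_vec
    by (intro lpa_free_add lpa_free_scale) simp_all
qed

lemma free_twist_gen: "free_twist a (gen g) = pm_scale (gen_weight a g) (gen g)"
  by (simp add: gen_def free_twist_basis_vec)

text \<open>Each relation is an eigenvector of the twist. In (4), and in (3) for equal arrows, the
  weights of arrow and ghost must cancel, which needs them to be nonzero.\<close>

lemma free_twist_lpa_rels:
  fixes Q :: "('v, 'e) pre_digraph" and r :: "('v, 'e, 'k::field) lfree"
  assumes "r \<in> lpa_rels Q" and nz: "\<And>b. b \<in> arcs Q \<Longrightarrow> a b \<noteq> 0"
  shows "free_twist a r \<in> lpa_ideal Q"
proof -
  note lin = pm_linear_diff [OF pm_linear_free_twist] pm_linear_sum [OF pm_linear_free_twist]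
    pm_linear_zero [OF pm_linear_free_twist] free_twist_mult free_twist_gen pm_scale_mult_left
    pm_scale_mult_right if_distrib [of "free_twist a"] pm.scale_scale gen_weight.simps mult_1 mult_1_right
    pm.scale_one
  have "\<exists>c. free_twist a r = pm_scale c r"
    using assms(1)
  proof cases
    case (rel0 i j)
    then show ?thesis by (intro exI [of _ 1]) (simp only: lin)
  next
    case (rel1_left b)
    then show ?thesis by (intro exI [of _ "a b"]) (simp only: lin pm.scale_right_diff_distrib)
  next
    case (rel1_right b)
    then show ?thesis by (intro exI [of _ "a b"]) (simp only: lin pm.scale_right_diff_distrib)
  next
    case (rel2_left b)
    then show ?thesis by (intro exI [of _ "inverse (a b)"]) (simp only: lin pm.scale_right_diff_distrib)
  next
    case (rel2_right b)
    then show ?thesis by (intro exI [of _ "inverse (a b)"]) (simp only: lin pm.scale_right_diff_distrib)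
  next
    case (rel3 b b')
    show ?thesis
    proof (cases "b = b'")
      case True
      then have "r = gen (Arr b) * gen (Ghost b) - gen (Vert (head Q b))" "a b \<noteq> 0"
        using rel3 nz by simp_all
      then show ?thesis
        by (intro exI [of _ 1]) (simp only: lin left_inverse simp_thms)
    next
      case False
      then have "r = gen (Arr b) * gen (Ghost b')"
        using rel3 by simp
      then show ?thesis
        by (intro exI [of _ "inverse (a b') * a b"]) (simp only: lin)
    qed
  next
    case (rel4 i)
    have "free_twist a (\<Sum>b\<in>out_arcs Q i. gen (Ghost b) * gen (Arr b))
        = (\<Sum>b\<in>out_arcs Q i. gen (Ghost b) * gen (Arr b) :: ('v, 'e, 'k) lfree)"
      unfolding lin using nz by (intro sum.cong) (auto simp: mult.commute)
    then have "free_twist a r = r"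
      by (simp only: rel4(1) pm_linear_diff [OF pm_linear_free_twist] free_twist_gen
          gen_weight.simps pm.scale_one)
    then show ?thesis
      by (intro exI [of _ 1]) (simp only: pm.scale_one)
  qed
  then show ?thesis
    using assms(1) by (metis lpa_ideal.rel lpa_ideal.scale)
qed

lemma free_twist_lpa_ideal:
  assumes "x \<in> lpa_ideal Q" and nz: "\<And>b. b \<in> arcs Q \<Longrightarrow> a b \<noteq> 0"
  shows "free_twist a x \<in> lpa_ideal Q"
  using assms(1)
  by induction (simp_all add: pm_linear_zero [OF pm_linear_free_twist]
      pm_linear_add [OF pm_linear_free_twist] pm_linear_scale [OF pm_linear_free_twist]
      free_twist_mult lpa_ideal.intros free_twist_lpa_rels nz free_twist_in_lpa_free)

lemma lpa_twist_coset:
  assumes "\<And>b. b \<in> arcs Q \<Longrightarrow> a b \<noteq> 0"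
  shows "lpa_twist Q a (lpa_coset Q x) = lpa_coset Q (free_twist a x)"
  unfolding lpa_twist_def free_twist_def [symmetric]
  by (intro UN_lpa_coset)
    (simp add: free_twist_lpa_ideal assms flip: pm_linear_diff [OF pm_linear_free_twist])

lemma lpa_rels_subset:
  fixes Q :: "('v, 'e) pre_digraph" and r :: "('v, 'e, 'k::field) lfree"
  assumes "wf_digraph Q" and "r \<in> lpa_rels Q"
  shows "r \<in> lpa_free Q"
proof -
  interpret wf_digraph Q by fact
  show ?thesis
    using assms(2)
    by cases (auto intro!: lpa_free_diff lpa_free_mult lpa_free_sum simp: lpa_free_zero regular_verts_def)
qed

text \<open>The ideal absorbs only multipliers from \<open>lpa_free\<close>. This inclusion makes
  every representative of the coset of an element of \<open>lpa_free\<close> such a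
  multiplier.\<close>

lemma lpa_ideal_subset:
  assumes "wf_digraph Q" and "x \<in> lpa_ideal Q"
  shows "x \<in> lpa_free Q"
  using assms(2)
  by induction (auto intro: lpa_free_zero lpa_rels_subset [OF assms(1)] lpa_free_add lpa_free_scale lpa_free_mult)

lemma acarrier_lpa: "acarrier (lpa Q) = lpa_coset Q ` lpa_free Q"
  by (simp add: lpa_def)

lemma ascale_lpa: "ascale (lpa Q) c (lpa_coset Q x) = lpa_coset Q (pm_scale c x)"
  unfolding lpa_def by (simp add: UN_lpa_coset lpa_ideal.scale flip: pm.scale_right_diff_distrib)

lemma aplus_lpa: "aplus (lpa Q) (lpa_coset Q x) (lpa_coset Q y) = lpa_coset Q (x + y)"
proof -
  have "(\<Union>y'\<in>lpa_coset Q y. lpa_coset Q (x' + y')) = lpa_coset Q (x' + y)" for x' :: "('a, 'b, 'c) lfree"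
    by (intro UN_lpa_coset) simp
  then show ?thesis
    unfolding lpa_def by (simp add: UN_lpa_coset)
qed

lemma amult_lpa:
  assumes "wf_digraph Q" "x \<in> lpa_free Q" "y \<in> lpa_free Q"
  shows "amult (lpa Q) (lpa_coset Q x) (lpa_coset Q y) = lpa_coset Q (x * y)"
proof -
  have "x' * y' - x * y \<in> lpa_ideal Q" if "x' \<in> lpa_coset Q x" "y' \<in> lpa_coset Q y" for x' y'
  proof -
    have "x' - x \<in> lpa_ideal Q" "y' - y \<in> lpa_ideal Q"
      using that by (simp_all add: mem_lpa_coset_iff)
    moreover from this have "x + (x' - x) \<in> lpa_free Q"
      by (intro lpa_free_add [OF assms(2)] lpa_ideal_subset [OF assms(1)])
    \<comment> \<open>The difference of the two products, split as
      \<open>x' * (y' - y) + (x' - x) * y\<close>.\<close>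
    ultimately have "(x + (x' - x)) * (y' - y) + (x' - x) * y \<in> lpa_ideal Q"
      by (intro lpa_ideal.add [OF lpa_ideal.mult_left lpa_ideal.mult_right [OF assms(3)]])
    then show ?thesis by (simp add: algebra_simps)
  qed
  then have "(\<Union>x'\<in>lpa_coset Q x. \<Union>y'\<in>lpa_coset Q y. lpa_coset Q (x' * y'))
      = (\<Union>x'\<in>lpa_coset Q x. \<Union>y'\<in>lpa_coset Q y. lpa_coset Q (x * y))"
    by (intro SUP_cong refl) (simp add: lpa_coset_eq_iff)
  also have "\<dots> = lpa_coset Q (x * y)"
    using mem_lpa_coset_self [of x Q] mem_lpa_coset_self [of y Q] by blast
  finally show ?thesis by (simp add: lpa_def)
qed

lemma is_repr_twisted:
  assumes wf: "wf_digraph Q" and M: "is_repr (lpa Q) M" and nz: "\<And>b. b \<in> arcs Q \<Longrightarrow> a b \<noteq> 0"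
  shows "is_repr (lpa Q) (twisted Q a M)"
proof -
  note [simp] = aplus_lpa ascale_lpa acarrier_lpa amult_lpa [OF wf] lpa_twist_coset [of Q a, OF nz]
    free_twist_in_lpa_free free_twist_mult
    pm_linear_add [OF pm_linear_free_twist] pm_linear_scale [OF pm_linear_free_twist]
  have sub: "acts_on (lpa Q) (rspace M) (rscale M) (ract M)"
    using M by (simp add: is_repr_iff)
  have "acts_on (lpa Q) (rspace M) (rscale M) (\<lambda>X. ract M (lpa_twist Q a X))"
    unfolding acts_on_def
    using sub unfolding acts_on_def acarrier_lpa ball_simps by (auto simp del: acarrier_lpa)
  then show ?thesis
    using M by (simp add: is_repr_iff twisted_def)
qed

section \<open>Modules given by generators acting on a basis\<close>

definition lpa_module_basis :: "('v, 'e) pre_digraph \<Rightarrow> 'b set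
    \<Rightarrow> (('v, 'e) lgen \<Rightarrow> 'b \<Rightarrow> ('b \<Rightarrow>\<^sub>0 'k::field)) \<Rightarrow> bool" where
  "lpa_module_basis Q B T \<longleftrightarrow>
     (\<forall>g\<in>lgens Q. \<forall>b\<in>B. T g b \<in> free_space B) \<and>
     (\<forall>r\<in>lpa_rels Q. \<forall>b\<in>B. gen_act T r (basis_vec b) = 0)"

text \<open>The relations vanish on basis vectors, hence on the whole space. For a right multiple
  \<open>x * u\<close>, the vector \<open>u\<close> applied to \<open>f\<close> must remain in the
  space, so that the induction hypothesis for \<open>x\<close> applies to it.\<close>

lemma gen_act_lpa_ideal:
  assumes "lpa_module_basis Q B T" and "x \<in> lpa_ideal Q" and "f \<in> free_space B"
  shows "gen_act T x f = 0"
  using assms(2,3)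
proof (induction arbitrary: f)
  case zero
  then show ?case by (simp add: pm_linear_zero [OF pm_linear_gen_act_left])
next
  case (rel r)
  show ?case
    by (rule pm_linear_eq_0 [OF pm_linear_gen_act_right rel(2)])
      (use assms(1) rel(1) in \<open>simp add: lpa_module_basis_def\<close>)
next
  case (add x y)
  then show ?case by (simp add: pm_linear_add [OF pm_linear_gen_act_left])
next
  case (scale x c)
  then show ?case by (simp add: pm_linear_scale [OF pm_linear_gen_act_left])
next
  case (mult_left u x)
  then show ?case by (simp add: gen_act_mult pm_linear_zero [OF pm_linear_gen_act_right])
next
  case (mult_right u x)
  then show ?case
    using assms(1) gen_act_in_free_space [of u Q f B T]
    by (simp add: gen_act_mult lpa_module_basis_def)
qed

text \<open>As the ideal acts by zero, the image of a coset is a singleton, and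
  \<open>the_elem\<close> returns the action of any representative.\<close>

lemma ract_basis_repr:
  assumes "lpa_module_basis Q B T" and "f \<in> free_space B"
  shows "ract (basis_repr B T) (lpa_coset Q u) f = gen_act T u f"
proof -
  have "(\<lambda>u. gen_act T u f) ` lpa_coset Q u = {gen_act T u f}"
    using mem_lpa_coset_self [of u Q] gen_act_lpa_ideal [OF assms(1) _ assms(2)]
      pm_linear_diff [OF pm_linear_gen_act_left, of T _ _ f]
    by (force simp: mem_lpa_coset_iff)
  then show ?thesis by (simp add: basis_repr_def)
qed

lemma is_repr_basis_repr:
  fixes Q :: "('v, 'e) pre_digraph" and T :: "('v, 'e) lgen \<Rightarrow> 'b \<Rightarrow> ('b \<Rightarrow>\<^sub>0 'k::field)"
  assumes wf: "wf_digraph Q" and T: "lpa_module_basis Q B T"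
  shows "is_repr (lpa Q) (basis_repr B T)"
proof -
  have act: "ract (basis_repr B T) (lpa_coset Q u) f = gen_act T u f" if "f \<in> free_space B" for u f
    by (rule ract_basis_repr [OF T that])
  have closed: "gen_act T u f \<in> free_space B" if "u \<in> lpa_free Q" "f \<in> free_space B" for u f
    using that T by (intro gen_act_in_free_space) (auto simp: lpa_module_basis_def)
  have "acts_on (lpa Q) (free_space B) pm_scale (ract (basis_repr B T))"
    unfolding acts_on_def acarrier_lpa
    by (auto simp: act closed aplus_lpa ascale_lpa amult_lpa [OF wf] free_space_add free_space_scale
        pm_linear_add [OF pm_linear_gen_act_right] pm_linear_scale [OF pm_linear_gen_act_right]
        pm_linear_add [OF pm_linear_gen_act_left] pm_linear_scale [OF pm_linear_gen_act_left]
        gen_act_mult)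
  then show ?thesis
    by (simp add: is_repr_iff basis_repr_def vector_space_pm_scale subspace_free_space)
qed

section \<open>The representations on paths\<close>

lemmas gen_act_simps = pm_linear_diff [OF pm_linear_gen_act_left] pm_linear_sum [OF pm_linear_gen_act_left]
  pm_linear_zero [OF pm_linear_gen_act_left] gen_act_mult gen_act_gen
  pm_linear_zero [OF linear_lin_ext]

lemma case_nat_tau: "case_nat (p 0) (tau 1 p) = p"
  by (auto simp: tau_def fun_eq_iff split: nat.split)

lemma lpa_module_basis_F:
  fixes Q :: "('v, 'e) pre_digraph"
  assumes C: "C \<subseteq> left_inf_paths Q"
    and tau: "\<And>p. p \<in> C \<Longrightarrow> tau 1 p \<in> C"
    and cons: "\<And>a p. a \<in> arcs Q \<Longrightarrow> p \<in> C \<Longrightarrow> head Q a = tail Q (p 0) \<Longrightarrow> case_nat a p \<in> C"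
  shows "lpa_module_basis Q C (F_gen Q :: _ \<Rightarrow> _ \<Rightarrow> (_ \<Rightarrow>\<^sub>0 'k::field))"
  unfolding lpa_module_basis_def
proof (intro conjI ballI)
  fix g p assume "g \<in> lgens Q" "p \<in> C"
  then show "F_gen Q g p \<in> free_space C"
    by (cases g) (auto intro: tau [unfolded One_nat_def] cons)
next
  fix r :: "('v, 'e, 'k) lfree" and p
  assume r: "r \<in> lpa_rels Q" and "p \<in> C"
  then have p: "p 0 \<in> arcs Q" "head Q (p 0) = tail Q (tau 1 p 0)" "tau 1 (case_nat a p) = p" for a
    using C by (auto simp: left_inf_paths_def tau_def)
  note case_nat_tau [of p, unfolded One_nat_def, simp]
  show "gen_act (F_gen Q) r (basis_vec p) = 0"
    using r
  proof cases
    case (rel4 i)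
    \<comment> \<open>Only the first arrow of \<open>p\<close> survives in the sum of relation (4):
      it is removed and put back.\<close>
    have "gen_act (F_gen Q) (gen (Ghost a) * gen (Arr a)) (basis_vec p) = (if a = p 0 then basis_vec p else (0 :: _ \<Rightarrow>\<^sub>0 'k))" for a
      using p by (simp add: gen_act_simps)
    moreover have "finite (out_arcs Q i)"
      using rel4 by (auto simp: regular_verts_def infinite_emitters_def)
    ultimately show ?thesis
      using p rel4 by (simp add: gen_act_simps(1,2,5))
  qed (use p in \<open>auto simp: gen_act_simps\<close>)
qed

text \<open>A nontrivial path behaves like a left-infinite one. On the trivial path at
  \<open>i\<close> every arrow acts by zero, consistently with relation (4), because a sink is not
  regular.\<close>

lemma lpa_module_basis_N:
  fixes Q :: "('v, 'e) pre_digraph"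
  assumes wf: "wf_digraph Q" and i: "i \<in> sinks Q"
  shows "lpa_module_basis Q (paths_ending_at Q i) (N_gen Q :: _ \<Rightarrow> _ \<Rightarrow> (_ \<Rightarrow>\<^sub>0 'k::field))"
proof -
  interpret wf_digraph Q by fact
  show ?thesis
    unfolding lpa_module_basis_def
  proof (intro conjI ballI)
    fix g vp assume "g \<in> lgens Q" "vp \<in> paths_ending_at Q i"
    then show "N_gen Q g vp \<in> free_space (paths_ending_at Q i)"
      by (cases "(Q, g, vp)" rule: N_gen.cases) (auto simp: paths_ending_at_def awalk_Cons_iff)
  next
    fix r :: "('v, 'e, 'k) lfree" and vp
    assume r: "r \<in> lpa_rels Q" and "vp \<in> paths_ending_at Q i"
    then obtain v p where vp: "vp = (v, p)" "awalk v p i" by (auto simp: paths_ending_at_def)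
    show "gen_act (N_gen Q) r (basis_vec vp) = 0"
    proof (cases p)
      case Nil
      then have "vp = (i, [])" using vp by (simp add: awalk_Nil_iff)
      with r i show ?thesis
        by cases (auto simp: gen_act_simps sinks_def regular_verts_def)
    next
      case (Cons b p')
      then have b: "b \<in> arcs Q" "tail Q b = v" using vp by (auto simp: awalk_Cons_iff)
      show ?thesis
        using r
      proof cases
        case (rel4 j)
        have "gen_act (N_gen Q) (gen (Ghost a) * gen (Arr a)) (basis_vec vp) = (if a = b then basis_vec vp else (0 :: _ \<Rightarrow>\<^sub>0 'k))" for a
          using b vp Cons by (simp add: gen_act_simps)
        moreover have "finite (out_arcs Q j)"
          using rel4 by (auto simp: regular_verts_def infinite_emitters_def)
        ultimately show ?thesis
          using b vp rel4 by (simp add: gen_act_simps(1,2,5))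
      qed (use b vp Cons in \<open>auto simp: gen_act_simps\<close>)
    qed
  qed
qed

section \<open>Reduction to ghost paths\<close>

abbreviation word :: "'g list \<Rightarrow> ('g list \<Rightarrow>\<^sub>0 'k::field)" where
  "word \<equiv> basis_vec"

text \<open>The leading vertex keeps the word of a trivial path nonempty, as the non-unital algebra
  requires, and records the start of the path. In traversal order the ghosts of the arrows spell the
  ghost of the whole path.\<close>

definition ghost_path :: "'v \<Rightarrow> 'e list \<Rightarrow> ('v, 'e) lgen list" where
  "ghost_path v q = Vert v # map Ghost q"

definition lpa_eq :: "('v, 'e) pre_digraph \<Rightarrow> ('v, 'e, 'k::field) lfree \<Rightarrow> ('v, 'e, 'k) lfree \<Rightarrow> bool" where
  "lpa_eq Q x y \<longleftrightarrow> x - y \<in> lpa_ideal Q"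

lemma lpa_eq_0_iff: "lpa_eq Q x 0 \<longleftrightarrow> x \<in> lpa_ideal Q"
  by (simp add: lpa_eq_def)

lemma lpa_eq_refl [simp]: "lpa_eq Q x x"
  by (simp add: lpa_eq_def lpa_ideal.zero)

lemma lpa_eq_sym: "lpa_eq Q x y \<Longrightarrow> lpa_eq Q y x"
  by (metis lpa_coset_eq_iff lpa_eq_def)

lemma lpa_eq_trans [trans]: "lpa_eq Q x y \<Longrightarrow> lpa_eq Q y z \<Longrightarrow> lpa_eq Q x z"
  by (metis lpa_coset_eq_iff lpa_eq_def)

lemma lpa_eq_mem_ideal: "lpa_eq Q x y \<Longrightarrow> x \<in> lpa_ideal Q \<longleftrightarrow> y \<in> lpa_ideal Q"
  using lpa_eq_trans [of Q x y 0] lpa_eq_trans [of Q y x 0] lpa_eq_sym [of Q x y]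
  by (auto simp: lpa_eq_0_iff)

lemma lpa_eq_add: "lpa_eq Q x y \<Longrightarrow> lpa_eq Q x' y' \<Longrightarrow> lpa_eq Q (x + x') (y + y')"
  unfolding lpa_eq_def using lpa_ideal.add [of "x - y" Q "x' - y'"] by (simp add: algebra_simps)

lemma lpa_eq_scale: "lpa_eq Q x y \<Longrightarrow> lpa_eq Q (pm_scale c x) (pm_scale c y)"
  unfolding lpa_eq_def by (simp add: lpa_ideal.scale flip: pm.scale_right_diff_distrib)

lemma lpa_eq_sum: "(\<And>i. i \<in> S \<Longrightarrow> lpa_eq Q (f i) (h i)) \<Longrightarrow> lpa_eq Q (sum f S) (sum h S)"
  unfolding lpa_eq_def by (simp add: lpa_ideal_sum flip: sum_subtractf)

lemma lpa_eq_mult_left: "u \<in> lpa_free Q \<Longrightarrow> lpa_eq Q x y \<Longrightarrow> lpa_eq Q (u * x) (u * y)"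
  unfolding lpa_eq_def by (simp add: lpa_ideal.mult_left flip: right_diff_distrib)

lemma lpa_eq_mult_right: "u \<in> lpa_free Q \<Longrightarrow> lpa_eq Q x y \<Longrightarrow> lpa_eq Q (x * u) (y * u)"
  unfolding lpa_eq_def by (simp add: lpa_ideal.mult_right flip: left_diff_distrib)

text \<open>The empty word does not belong to \<open>lpa_free\<close>, so an empty context is
  treated separately from multiplication by a word.\<close>

lemma lpa_eq_append:
  assumes "lpa_eq Q (word w :: ('v, 'e, 'k::field) lfree) (word w')" "set u \<subseteq> lgens Q" "set r \<subseteq> lgens Q"
  shows "lpa_eq Q (word (u @ w @ r) :: ('v, 'e, 'k) lfree) (word (u @ w' @ r))"
proof -
  have "lpa_eq Q (word (w @ r) :: ('v, 'e, 'k) lfree) (word (w' @ r))"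
  proof (cases "r = []")
    case False
    then show ?thesis
      using lpa_eq_mult_right [OF _ assms(1), of "word r"] assms(3) by (simp add: basis_vec_mult)
  qed (use assms in simp)
  then show ?thesis
    using lpa_eq_mult_left [of "word u" Q "word (w @ r)" "word (w' @ r)"] assms(2)
    by (cases "u = []") (simp_all add: basis_vec_mult)
qed

lemma lpa_eq_append_0:
  assumes "lpa_eq Q (word w :: ('v, 'e, 'k::field) lfree) 0" "set u \<subseteq> lgens Q" "set r \<subseteq> lgens Q"
  shows "lpa_eq Q (word (u @ w @ r) :: ('v, 'e, 'k) lfree) 0"
proof -
  have "lpa_eq Q (word (w @ r) :: ('v, 'e, 'k) lfree) 0"
  proof (cases "r = []")
    case False
    then show ?thesis
      using lpa_eq_mult_right [OF _ assms(1), of "word r"] assms(3) by (simp add: basis_vec_mult)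
  qed (use assms in simp)
  then show ?thesis
    using lpa_eq_mult_left [of "word u" Q "word (w @ r)" 0] assms(2)
    by (cases "u = []") (simp_all add: basis_vec_mult)
qed

lemma
  fixes Q :: "('v, 'e) pre_digraph"
  shows lpa_eq_vert_vert: "i \<in> verts Q \<Longrightarrow> j \<in> verts Q \<Longrightarrow>
        lpa_eq Q (word [Vert i, Vert j] :: ('v, 'e, 'k::field) lfree) (if i = j then word [Vert i] else 0)"
    and lpa_eq_arr_tail: "a \<in> arcs Q \<Longrightarrow>
        lpa_eq Q (word [Arr a, Vert (tail Q a)] :: ('v, 'e, 'k) lfree) (word [Arr a])"
    and lpa_eq_tail_ghost: "a \<in> arcs Q \<Longrightarrow>
        lpa_eq Q (word [Vert (tail Q a), Ghost a] :: ('v, 'e, 'k) lfree) (word [Ghost a])"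
    and lpa_eq_ghost_head: "a \<in> arcs Q \<Longrightarrow>
        lpa_eq Q (word [Ghost a, Vert (head Q a)] :: ('v, 'e, 'k) lfree) (word [Ghost a])"
    and lpa_eq_arr_ghost: "a \<in> arcs Q \<Longrightarrow> b \<in> arcs Q \<Longrightarrow>
        lpa_eq Q (word [Arr a, Ghost b] :: ('v, 'e, 'k) lfree) (if a = b then word [Vert (head Q a)] else 0)"
  unfolding lpa_eq_def
  using lpa_rels.rel0 [of i Q j, THEN lpa_ideal.rel] lpa_rels.rel1_right [of a Q, THEN lpa_ideal.rel]
    lpa_rels.rel2_left [of a Q, THEN lpa_ideal.rel] lpa_rels.rel2_right [of a Q, THEN lpa_ideal.rel]
    lpa_rels.rel3 [of a Q b, THEN lpa_ideal.rel]
  unfolding gen_def basis_vec_mult append_Cons append_Nil by blast+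

text \<open>The vertex whose idempotent fixes the generator from the right; a ghost arrow runs
  backwards, which accounts for \<open>head\<close> there.\<close>

fun lgen_source :: "('v, 'e) pre_digraph \<Rightarrow> ('v, 'e) lgen \<Rightarrow> 'v" where
  "lgen_source Q (Vert i) = i"
| "lgen_source Q (Arr a) = tail Q a"
| "lgen_source Q (Ghost a) = head Q a"

lemma lpa_eq_source:
  fixes Q :: "('v, 'e) pre_digraph"
  assumes "g \<in> lgens Q"
  shows "lpa_eq Q (word [g, Vert (lgen_source Q g)] :: ('v, 'e, 'k::field) lfree) (word [g])"
proof (cases g)
  case (Vert i)
  then show ?thesis using lpa_eq_vert_vert [of i Q i, where 'k='k] assms by simp
next
  case (Arr a)
  then show ?thesis using lpa_eq_arr_tail [of a Q, where 'k='k] assms by simp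
next
  case (Ghost a)
  then show ?thesis using lpa_eq_ghost_head [of a Q, where 'k='k] assms by simp
qed

section \<open>Rewriting products with ghost paths\<close>

context wf_digraph
begin

lemma lgen_source_in_verts [simp]: "g \<in> lgens G \<Longrightarrow> lgen_source G g \<in> verts G"
  by (cases g) auto

lemma set_ghost_path: "awalk v q t \<Longrightarrow> set (ghost_path v q) \<subseteq> lgens G"
  by (auto simp: ghost_path_def awalk_def)

lemma lpa_eq_append_vert:
  assumes "g \<in> lgens G" "v \<in> verts G" "set r \<subseteq> lgens G"
  shows "lpa_eq G (word (g # Vert v # r) :: ('a, 'b, 'k::field) lfree)
    (if v = lgen_source G g then word (g # r) else 0)"
proof (cases "v = lgen_source G g")
  case True
  then show ?thesis
    using lpa_eq_append [OF lpa_eq_source [OF assms(1), where 'k='k], of "[]" r] assms by simp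
next
  case False
  have "lpa_eq G (word (g # Vert (lgen_source G g) # Vert v # r) :: ('a, 'b, 'k) lfree) (word (g # Vert v # r))"
    using lpa_eq_append [OF lpa_eq_source [OF assms(1), where 'k='k], of "[]" "Vert v # r"] assms by simp
  moreover have "lpa_eq G (word (g # Vert (lgen_source G g) # Vert v # r) :: ('a, 'b, 'k) lfree) 0"
    using lpa_eq_append_0 [of G "[Vert (lgen_source G g), Vert v]" "[g]" r]
      lpa_eq_vert_vert [of "lgen_source G g" G v] False assms by auto
  ultimately show ?thesis
    using False by (auto intro: lpa_eq_trans lpa_eq_sym)
qed

lemma ghost_path_Cons:
  assumes "a \<in> arcs G" "set q \<subseteq> arcs G"
  shows "lpa_eq G (word (Ghost a # map Ghost q) :: ('a, 'b, 'k::field) lfree) (word (ghost_path (tail G a) (a # q)))"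
proof -
  have "set (map Ghost q) \<subseteq> (lgens G :: ('a, 'b) lgen set)"
    using assms by auto
  then show ?thesis
    using lpa_eq_append [OF lpa_eq_tail_ghost [OF assms(1), where 'k='k], of "[]" "map Ghost q"]
    by (simp add: ghost_path_def lpa_eq_sym)
qed

text \<open>If the product is nonzero, a vertex is absorbed, a ghost arrow lengthens the path, and
  an arrow cancels its first ghost by relation (3). The length thus drops by at most one. An arrow
  meets an empty path only at a vertex it starts from, which is impossible at a sink.\<close>

lemma lpa_eq_gen_ghost_path:
  assumes g: "g \<in> lgens G" and q: "awalk v q t" "q \<noteq> [] \<or> t \<in> sinks G"
  obtains "lpa_eq G (word (g # ghost_path v q) :: ('a, 'b, 'k::field) lfree) 0"
  | v' q' where "awalk v' q' t" "length q \<le> Suc (length q')"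
      "lpa_eq G (word (g # ghost_path v q) :: ('a, 'b, 'k) lfree) (word (ghost_path v' q'))"
proof -
  have v: "v \<in> verts G" and arcs: "set q \<subseteq> arcs G" "set (map Ghost q) \<subseteq> (lgens G :: ('a, 'b) lgen set)"
    using q(1) by (auto simp: awalk_def)
  note src = lpa_eq_append_vert [OF g v arcs(2), where 'k='k, folded ghost_path_def]
  show ?thesis
  proof (cases "v = lgen_source G g")
    case False
    then show ?thesis using src that(1) by simp
  next
    case True
    show ?thesis
    proof (cases g)
      case (Vert i)
      then show ?thesis
        using src True q(1) that(2) [of v q] by (simp add: ghost_path_def)
    next
      case (Ghost a)
      then have a: "a \<in> arcs G" "head G a = v" using g True by simp_all
      then have "awalk (tail G a) (a # q) t" using q(1) by (simp add: awalk_Cons_iff)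
      moreover have "lpa_eq G (word (g # ghost_path v q) :: ('a, 'b, 'k) lfree) (word (ghost_path (tail G a) (a # q)))"
        using src True Ghost ghost_path_Cons [OF a(1) arcs(1)] by (auto intro: lpa_eq_trans)
      ultimately show ?thesis using that(2) by fastforce
    next
      case (Arr a)
      then have a: "a \<in> arcs G" "tail G a = v" using g True by simp_all
      have "q \<noteq> []"
      proof
        assume "q = []"
        then have "v \<in> sinks G" using q by (simp add: awalk_Nil_iff)
        then show False using a by (auto simp: sinks_def out_arcs_def)
      qed
      then obtain b q' where q': "q = b # q'" by (cases q) auto
      then have b: "b \<in> arcs G" "awalk (head G b) q' t" using q(1) by (auto simp: awalk_Cons_iff)
      have eq: "lpa_eq G (word (g # ghost_path v q) :: ('a, 'b, 'k) lfree) (word ([] @ [Arr a, Ghost b] @ map Ghost q'))"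
        using src True Arr q' by simp
      show ?thesis
      proof (cases "a = b")
        case True
        have "lpa_eq G (word ([] @ [Arr a, Ghost b] @ map Ghost q') :: ('a, 'b, 'k) lfree)
            (word ([] @ [Vert (head G b)] @ map Ghost q'))"
          using lpa_eq_arr_ghost [OF a(1) b(1), where 'k='k] True arcs(2) q' by (intro lpa_eq_append) simp_all
        with eq have "lpa_eq G (word (g # ghost_path v q) :: ('a, 'b, 'k) lfree) (word (ghost_path (head G b) q'))"
          unfolding ghost_path_def by (auto intro: lpa_eq_trans)
        then show ?thesis using that(2) b q' by simp
      next
        case False
        have "lpa_eq G (word ([] @ [Arr a, Ghost b] @ map Ghost q') :: ('a, 'b, 'k) lfree) 0"
          using lpa_eq_arr_ghost [OF a(1) b(1), where 'k='k] False arcs(2) q' by (intro lpa_eq_append_0) simp_all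
        with eq show ?thesis using that(1) by (blast intro: lpa_eq_trans)
      qed
    qed
  qed
qed

text \<open>The letter next to the ghost path acts first, hence the reverse induction. Each letter
  uses up at most one ghost, so a path at least as long as \<open>w\<close> suffices; at a sink no
  bound on the length is required.\<close>

lemma lpa_eq_word_ghost_path:
  assumes "set w \<subseteq> lgens G" and "awalk v q t" and "length w \<le> length q \<or> t \<in> sinks G"
  shows "lpa_eq G (word (w @ ghost_path v q) :: ('a, 'b, 'k::field) lfree) 0 \<or>
    (\<exists>v' p. awalk v' p t \<and> lpa_eq G (word (w @ ghost_path v q) :: ('a, 'b, 'k) lfree) (word (ghost_path v' p)))"
  using assms
proof (induction w arbitrary: v q rule: rev_induct)
  case Nil
  then show ?case by (auto intro: lpa_eq_refl)
next
  case (snoc g w)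
  have g: "g \<in> lgens G" and w: "set w \<subseteq> lgens G" and q: "q \<noteq> [] \<or> t \<in> sinks G"
    using snoc.prems by auto
  from g snoc.prems(2) q show ?case
  proof (cases rule: lpa_eq_gen_ghost_path [where 'k='k])
    case 1
    then show ?thesis
      using lpa_eq_append_0 [OF 1 w, of "[]"] by simp
  next
    case (2 v' q')
    have "lpa_eq G (word ((w @ [g]) @ ghost_path v q) :: ('a, 'b, 'k) lfree) (word (w @ ghost_path v' q'))"
      using lpa_eq_append [OF 2(3) w, of "[]"] by simp
    moreover have "length w \<le> length q' \<or> t \<in> sinks G"
      using snoc.prems(3) 2(2) by auto
    ultimately show ?thesis
      using snoc.IH [OF w 2(1)] by (meson lpa_eq_trans)
  qed
qed

definition ghost_span :: "'a \<Rightarrow> ('a, 'b, 'k::field) lfree set" where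
  "ghost_span t = free_space {ghost_path v p | v p. awalk v p t}"

lemma mult_ghost_path_in_ghost_span:
  fixes x :: "('a, 'b, 'k::field) lfree"
  assumes "x \<in> lpa_free G"
  obtains n where "\<And>v q t. awalk v q t \<Longrightarrow> n \<le> length q \<or> t \<in> sinks G \<Longrightarrow>
    \<exists>y\<in>ghost_span t. lpa_eq G (x * word (ghost_path v q)) y"
proof -
  have "\<exists>n. \<forall>v q t. awalk v q t \<longrightarrow> n \<le> length q \<or> t \<in> sinks G \<longrightarrow>
    (\<exists>y\<in>ghost_span t. lpa_eq G (x * word (ghost_path v q)) y)"
    using assms
  proof (induction rule: lpa_free_induct)
    case zero
    show ?case
      by (intro exI [of _ 0] allI impI bexI [of _ 0]) (simp_all add: ghost_span_def)
  next
    case (add w c f)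
    then obtain n where n: "awalk v q t \<Longrightarrow> n \<le> length q \<or> t \<in> sinks G \<Longrightarrow>
      \<exists>y\<in>ghost_span t. lpa_eq G (f * word (ghost_path v q)) y" for v q t by blast
    \<comment> \<open>The bound \<open>n\<close> serves \<open>f\<close>, and
      \<open>length w\<close> serves the new word.\<close>
    show ?case
    proof (intro exI [of _ "max n (length w)"] allI impI)
      fix v q t assume q: "awalk v q t" "max n (length w) \<le> length q \<or> t \<in> sinks G"
      then obtain y where y: "y \<in> ghost_span t" "lpa_eq G (f * word (ghost_path v q)) y"
        using n [of v q t] by auto
      obtain z where z: "z \<in> ghost_span t" "lpa_eq G (word (w @ ghost_path v q) :: ('a, 'b, 'k) lfree) z"
      proof (cases "lpa_eq G (word (w @ ghost_path v q) :: ('a, 'b, 'k) lfree) 0")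
        case True
        then show ?thesis using that [of 0] by (simp add: ghost_span_def)
      next
        case False
        moreover have "length w \<le> length q \<or> t \<in> sinks G" using q(2) by auto
        ultimately obtain v' p where "awalk v' p t"
            "lpa_eq G (word (w @ ghost_path v q) :: ('a, 'b, 'k) lfree) (word (ghost_path v' p))"
          using lpa_eq_word_ghost_path [OF add(2) q(1), where 'k='k] by blast
        then show ?thesis using that [of "word (ghost_path v' p)"] by (auto simp: ghost_span_def)
      qed
      have "pm_scale c z + y \<in> ghost_span t"
        using y z unfolding ghost_span_def by (intro free_space_add free_space_scale)
      moreover have "lpa_eq G ((pm_scale c (word w) + f) * word (ghost_path v q)) (pm_scale c z + y)"
        unfolding distrib_right pm_scale_mult_left basis_vec_mult
        by (intro lpa_eq_add lpa_eq_scale y z)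
      ultimately show "\<exists>y\<in>ghost_span t. lpa_eq G ((pm_scale c (word w) + f) * word (ghost_path v q)) y"
        by blast
    qed
  qed
  then show ?thesis using that by blast
qed

text \<open>A word is fixed from the right by the source of its last letter and killed by all other
  vertices. Allowing every finite \<open>S'\<close> above \<open>S\<close> lets one set of vertices
  serve several words at once.\<close>

lemma local_unit:
  fixes x :: "('a, 'b, 'k::field) lfree"
  assumes "x \<in> lpa_free G"
  shows "\<exists>S. finite S \<and> S \<subseteq> verts G \<and>
    (\<forall>S'. finite S' \<longrightarrow> S' \<subseteq> verts G \<longrightarrow> S \<subseteq> S' \<longrightarrow> lpa_eq G (\<Sum>v\<in>S'. x * word [Vert v]) x)"
  using assms
proof (induction rule: lpa_free_induct)
  case zero
  show ?case by (intro exI [of _ "{}"]) simp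
next
  case (add w c f)
  then obtain S where S: "finite S" "S \<subseteq> verts G"
    "\<And>S'. finite S' \<Longrightarrow> S' \<subseteq> verts G \<Longrightarrow> S \<subseteq> S' \<Longrightarrow> lpa_eq G (\<Sum>v\<in>S'. f * word [Vert v]) f"
    by blast
  obtain u g where w: "w = u @ [g]" using add(1) by (cases w rule: rev_exhaust) auto
  define s where "s = lgen_source G g"
  have g: "g \<in> lgens G" and u: "set u \<subseteq> lgens G" using add(2) w by auto
  have eq: "lpa_eq G (word (w @ [Vert v]) :: ('a, 'b, 'k) lfree) (if v = s then word w else 0)" if "v \<in> verts G" for v
    using lpa_eq_append_vert [OF g that, of "[]", where 'k='k]
      lpa_eq_append [of G "[g, Vert v]" "[g]" u "[]", where 'k='k]
      lpa_eq_append_0 [of G "[g, Vert v]" u "[]", where 'k='k] u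
    by (auto simp: w s_def split: if_splits)
  show ?case
  proof (intro exI [of _ "insert s S"] conjI allI impI)
    fix S' assume S': "finite S'" "S' \<subseteq> verts G" "insert s S \<subseteq> S'"
    have "lpa_eq G (\<Sum>v\<in>S'. word (w @ [Vert v]) :: ('a, 'b, 'k) lfree) (\<Sum>v\<in>S'. if v = s then word w else 0)"
      using S' by (intro lpa_eq_sum eq) auto
    then have "lpa_eq G (\<Sum>v\<in>S'. word (w @ [Vert v]) :: ('a, 'b, 'k) lfree) (word w)"
      using S' by simp
    then have "lpa_eq G (pm_scale c (\<Sum>v\<in>S'. word (w @ [Vert v])) + (\<Sum>v\<in>S'. f * word [Vert v])) (pm_scale c (word w) + f)"
      using S' by (intro lpa_eq_add lpa_eq_scale S(3)) auto
    then show "lpa_eq G (\<Sum>v\<in>S'. (pm_scale c (word w) + f) * word [Vert v]) (pm_scale c (word w) + f)"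
      unfolding distrib_right pm_scale_mult_left basis_vec_mult sum.distrib pm.scale_sum_right .
  qed (use S g in \<open>auto simp: s_def\<close>)
qed

lemma lpa_ideal_if_mult_vert:
  fixes x :: "('a, 'b, 'k::field) lfree"
  assumes "x \<in> lpa_free G" and "\<And>v. v \<in> verts G \<Longrightarrow> x * word [Vert v] \<in> lpa_ideal G"
  shows "x \<in> lpa_ideal G"
proof -
  obtain S where "S \<subseteq> verts G" "lpa_eq G (\<Sum>v\<in>S. x * word [Vert v]) x"
    using local_unit [OF assms(1)] by blast
  moreover have "(\<Sum>v\<in>S. x * word [Vert v]) \<in> lpa_ideal G"
    using \<open>S \<subseteq> verts G\<close> assms(2) by (intro lpa_ideal_sum) auto
  ultimately show ?thesis
    using lpa_eq_mem_ideal by blast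
qed

text \<open>This is the expansion of a vertex by relation (4), one arrow at a time. The induction
  generalises \<open>x\<close>: the hypothesis is applied to \<open>x * word [Ghost a]\<close> at
  the head of each arrow \<open>a\<close> leaving \<open>v\<close>, and multiplying by
  \<open>Arr a\<close> and summing gives back \<open>x * word [Vert v]\<close>. At a sink, or for
  \<open>n = 0\<close>, the trivial path already suffices.\<close>

lemma lpa_ideal_if_mult_ghost_path:
  fixes x :: "('a, 'b, 'k::field) lfree"
  assumes "row_finite G" and "x \<in> lpa_free G" and "v \<in> verts G"
    and "\<And>q t. awalk v q t \<Longrightarrow> n \<le> length q \<or> t \<in> sinks G \<Longrightarrow> x * word (ghost_path v q) \<in> lpa_ideal G"
  shows "x * word [Vert v] \<in> lpa_ideal G"
  using assms(2-)
proof (induction n arbitrary: x v)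
  case 0
  show ?case using 0(3) [of "[]" v] 0(2) by (simp add: ghost_path_def awalk_Nil_iff)
next
  case (Suc n)
  show ?case
  proof (cases "v \<in> sinks G")
    case True
    then show ?thesis using Suc.prems(3) [of "[]" v] Suc.prems(2) by (simp add: ghost_path_def awalk_Nil_iff)
  next
    case False
    then have reg: "v \<in> regular_verts G"
      using Suc.prems(2) assms(1) by (simp add: regular_verts_def row_finite_def)
    have "x * word [Ghost a] \<in> lpa_ideal G" if a: "a \<in> out_arcs G v" for a
    proof -
      have a': "a \<in> arcs G" "tail G a = v" using a by auto
      let ?x = "x * word [Ghost a]"
      have "?x \<in> lpa_free G" using Suc.prems(1) a' by (intro lpa_free_mult) simp_all
      moreover have "?x * word (ghost_path (head G a) q) \<in> lpa_ideal G"
        if q: "awalk (head G a) q t" "n \<le> length q \<or> t \<in> sinks G" for q t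
      proof -
        have arcs: "set q \<subseteq> arcs G" "set (map Ghost q) \<subseteq> (lgens G :: ('a, 'b) lgen set)"
          using q(1) by (auto simp: awalk_def)
        \<comment> \<open>\<open>Ghost a\<close> followed by the ghost path of \<open>q\<close> is,
          up to absorbed vertices, the ghost path of \<open>a # q\<close>, which is one arrow
          longer.\<close>
        have "lpa_eq G (word (Ghost a # Vert (head G a) # map Ghost q) :: ('a, 'b, 'k) lfree) (word (Ghost a # map Ghost q))"
          using lpa_eq_append_vert [of "Ghost a" "head G a" "map Ghost q", where 'k='k] a' arcs by simp
        also have "lpa_eq G (word (Ghost a # map Ghost q) :: ('a, 'b, 'k) lfree) (word (ghost_path v (a # q)))"
          using ghost_path_Cons [OF a'(1) arcs(1)] a'(2) by simp
        finally have "lpa_eq G (x * word (Ghost a # Vert (head G a) # map Ghost q)) (x * word (ghost_path v (a # q)))"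
          using Suc.prems(1) by (intro lpa_eq_mult_left)
        moreover have "x * word (ghost_path v (a # q)) \<in> lpa_ideal G"
          using q a' by (intro Suc.prems(3) [of _ t]) (auto simp: awalk_Cons_iff)
        moreover have "?x * word (ghost_path (head G a) q) = x * word (Ghost a # Vert (head G a) # map Ghost q)"
          by (simp add: mult.assoc basis_vec_mult ghost_path_def)
        ultimately show ?thesis
          using lpa_eq_mem_ideal by metis
      qed
      ultimately have "?x * word [Vert (head G a)] \<in> lpa_ideal G"
        using a' by (intro Suc.IH) auto
      moreover have "lpa_eq G (x * word [Ghost a, Vert (head G a)]) ?x"
        using Suc.prems(1) a' by (intro lpa_eq_mult_left lpa_eq_ghost_head)
      ultimately show ?thesis
        by (simp add: lpa_eq_mem_ideal mult.assoc basis_vec_mult)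
    qed
    then have "(\<Sum>a\<in>out_arcs G v. (x * word [Ghost a]) * gen (Arr a)) \<in> lpa_ideal G"
      by (intro lpa_ideal_sum lpa_ideal.mult_right [of "gen (Arr _)"]) simp_all
    then have "x * (\<Sum>a\<in>out_arcs G v. gen (Ghost a) * gen (Arr a)) \<in> lpa_ideal G"
      by (simp only: sum_distrib_left mult.assoc gen_def)
    moreover have "lpa_eq G (x * (\<Sum>a\<in>out_arcs G v. gen (Ghost a) * gen (Arr a))) (x * word [Vert v])"
      using lpa_rels.rel4 [OF reg, THEN lpa_ideal.rel, where 'k='k] Suc.prems(1)
      by (intro lpa_eq_mult_left) (simp_all add: lpa_eq_def gen_def)
    ultimately show ?thesis
      using lpa_eq_mem_ideal by blast
  qed
qed

lemma lpa_ideal_if_ghost_span: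
  fixes x :: "('a, 'b, 'k::field) lfree"
  assumes "row_finite G" and x: "x \<in> lpa_free G"
    and inj: "\<And>v q t y. awalk v q t \<Longrightarrow> y \<in> ghost_span t \<Longrightarrow> lpa_eq G (x * word (ghost_path v q)) y \<Longrightarrow> y = 0"
  shows "x \<in> lpa_ideal G"
proof (rule lpa_ideal_if_mult_vert [OF x])
  fix v assume v: "v \<in> verts G"
  obtain n where n: "\<And>v q t. awalk v q t \<Longrightarrow> n \<le> length q \<or> t \<in> sinks G \<Longrightarrow>
    \<exists>y\<in>ghost_span t. lpa_eq G (x * word (ghost_path v q)) y"
    by (rule mult_ghost_path_in_ghost_span [OF x]) blast
  show "x * word [Vert v] \<in> lpa_ideal G"
  proof (rule lpa_ideal_if_mult_ghost_path [OF assms(1) x v])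
    fix q t assume q: "awalk v q t" "n \<le> length q \<or> t \<in> sinks G"
    then obtain y where "y \<in> ghost_span t" "lpa_eq G (x * word (ghost_path v q)) y"
      using n by blast
    with inj q(1) show "x * word (ghost_path v q) \<in> lpa_ideal G"
      by (metis lpa_eq_0_iff)
  qed
qed

end

section \<open>Independence of ghost paths\<close>

lemma pm_linear_expand:
  assumes "pm_linear h"
  shows "h y = (\<Sum>w\<in>Poly_Mapping.keys y. pm_scale (Poly_Mapping.lookup y w) (h (basis_vec w)))"
  unfolding lin_ext_def [symmetric] using assms linear_lin_ext
  by (rule pm_linear_eq) simp

text \<open>Comparing coefficients at a basis vector \<open>b\<close> gives a polynomial in \<open>\<mu>\<close> which vanishes
  outside \<open>0\<close>, and whose coefficients are the \<open>c w\<close> with \<open>g w = b\<close>.\<close>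

lemma scaled_family_independent:
  fixes c :: "'w \<Rightarrow> 'k::field" and g :: "'w \<Rightarrow> 'b"
  assumes "infinite (UNIV :: 'k set)" and "finite K"
    and eq: "\<And>\<mu>. \<mu> \<noteq> 0 \<Longrightarrow> (\<Sum>w\<in>K. pm_scale (c w * \<mu> ^ n w) (basis_vec (g w))) = 0"
    and inj: "\<And>w w'. w \<in> K \<Longrightarrow> w' \<in> K \<Longrightarrow> g w = g w' \<Longrightarrow> n w = n w' \<Longrightarrow> w = w'"
    and w: "w \<in> K"
  shows "c w = 0"
proof -
  let ?K = "{w' \<in> K. g w' = g w}"
  define P where "P = (\<Sum>w'\<in>?K. monom (c w') (n w'))"
  have "poly P \<mu> = 0" if "\<mu> \<noteq> 0" for \<mu>
  proof -
    have "poly P \<mu> = (\<Sum>w'\<in>K. if g w' = g w then c w' * \<mu> ^ n w' else 0)"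
      using \<open>finite K\<close> by (simp add: P_def poly_sum poly_monom flip: sum.inter_filter)
    also have "\<dots> = Poly_Mapping.lookup (\<Sum>w'\<in>K. pm_scale (c w' * \<mu> ^ n w') (basis_vec (g w'))) (g w)"
      unfolding lookup_sum by (intro sum.cong) (auto simp: lookup_basis_vec)
    finally show ?thesis using eq [OF that] by simp
  qed
  then have "UNIV - {0} \<subseteq> {\<mu>. poly P \<mu> = 0}" by auto
  then have "infinite {\<mu>. poly P \<mu> = 0}"
    using assms(1) by (metis finite_Diff2 finite.emptyI finite_insert finite_subset)
  then have "P = 0" using poly_roots_finite by blast
  then have "0 = coeff P (n w)" by simp
  also have "\<dots> = (\<Sum>w'\<in>?K. if w' = w then c w' else 0)"
    unfolding P_def coeff_sum using inj w by (intro sum.cong) auto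
  also have "\<dots> = c w" using w \<open>finite K\<close> by simp
  finally show ?thesis by simp
qed

section \<open>Prepending finite paths to left-infinite ones\<close>

definition conc :: "'e list \<Rightarrow> (nat \<Rightarrow> 'e) \<Rightarrow> (nat \<Rightarrow> 'e)" where
  "conc p r = foldr case_nat p r"

lemma conc_simps [simp]: "conc [] r = r" "conc (a # p) r = case_nat a (conc p r)"
  by (simp_all add: conc_def)

lemma conc_nth: "conc p r n = (if n < length p then p ! n else r (n - length p))"
  by (induction p arbitrary: n) (auto split: nat.split)

text \<open>Cancelling the arrows of the shorter list one by one leaves a remainder \<open>d\<close>
  that can be prepended to \<open>r\<close> without changing it.\<close>

lemma conc_eq_prefix:
  assumes "conc p r = conc p' r" and "length p \<le> length p'"
  obtains d where "p' = p @ d" "conc d r = r"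
proof -
  have "\<exists>d. p' = p @ d \<and> conc d r = r"
    using assms
  proof (induction p arbitrary: p')
    case (Cons a p)
    then obtain b p1 where p': "p' = b # p1" by (cases p') auto
    have eq: "case_nat a (conc p r) n = case_nat b (conc p1 r) n" for n
      using Cons.prems(1) p' by simp
    have "a = b" using eq [of 0] by simp
    moreover have "conc p r = conc p1 r" using eq [of "Suc _"] by (auto simp: fun_eq_iff)
    ultimately show ?case using Cons.IH [of p1] Cons.prems(2) p' by simp
  qed auto
  then show ?thesis using that by blast
qed

text \<open>The equation makes \<open>r\<close> periodic with period \<open>length d\<close> and
  first period \<open>d\<close>; strong induction subtracts one period.\<close>

lemma conc_fixed_point:
  assumes "conc d r = r" and "d \<noteq> []"
  shows "r = cycle_inf d"
proof
  fix n
  show "r n = cycle_inf d n"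
  proof (induction n rule: less_induct)
    case (less n)
    have "r n = (if n < length d then d ! n else r (n - length d))"
      using assms(1) conc_nth [of d r n] by simp
    moreover have "n - length d < n" if "\<not> n < length d"
      using that assms(2) by (cases d) auto
    ultimately show ?case
      using less [of "n - length d"] assms(2) by (auto simp: cycle_inf_def le_mod_geq)
  qed
qed

lemma tail_equiv_refl [simp]: "tail_equiv p p"
  unfolding tail_equiv_def by blast

lemma tail_class_tau: "q \<in> tail_class Q p \<Longrightarrow> tau 1 q \<in> tail_class Q p"
proof -
  assume "q \<in> tail_class Q p"
  then obtain n m where q: "q \<in> left_inf_paths Q" "tau n p = tau m q"
    by (auto simp: tail_class_def tail_equiv_def)
  have "tau (Suc n) p = tau m (tau 1 q)"
    using q(2) by (auto simp: tau_def fun_eq_iff dest: spec [of _ "Suc _"])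
  then have "tail_equiv p (tau 1 q)" unfolding tail_equiv_def by blast
  then show ?thesis
    using q(1) by (simp add: tail_class_def left_inf_paths_def tau_def)
qed

lemma tail_class_Cons:
  assumes "q \<in> tail_class Q p" "a \<in> arcs Q" "head Q a = tail Q (q 0)"
  shows "case_nat a q \<in> tail_class Q p"
proof -
  obtain n m where q: "q \<in> left_inf_paths Q" "tau n p = tau m q"
    using assms(1) by (auto simp: tail_class_def tail_equiv_def)
  have "tau n p = tau (Suc m) (case_nat a q)"
    using q(2) by (simp add: tau_def)
  then have "tail_equiv p (case_nat a q)" unfolding tail_equiv_def by blast
  then show ?thesis
    using q(1) assms(2,3) by (simp add: tail_class_def left_inf_paths_def split: nat.split)
qed

lemma tail_equiv_cycle_inf:
  assumes "tail_equiv r (cycle_inf c)" and "c \<noteq> []"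
  shows "hd c \<in> range r"
proof -
  obtain n m where nm: "tau n r = tau m (cycle_inf c)"
    using assms(1) by (auto simp: tail_equiv_def)
  \<comment> \<open>The offset is chosen so that \<open>m + j\<close> is a multiple of
    \<open>length c\<close>, where the cyclic path reads its first arrow again.\<close>
  define j where "j = m * length c - m"
  have "m \<le> m * length c" using assms(2) by (cases c) auto
  then have "m + j = m * length c" by (simp add: j_def)
  then have "cycle_inf c (m + j) = c ! 0" by (simp add: cycle_inf_def)
  then have "r (n + j) = hd c"
    using nm assms(2) by (auto simp: tau_def fun_eq_iff hd_conv_nth)
  then show ?thesis by (metis rangeI)
qed

lemma free_twist_one:
  fixes x :: "('v, 'e, 'k::field) lfree"
  shows "free_twist (\<lambda>_. 1) x = x"
proof (rule pm_linear_eq [OF pm_linear_free_twist, of "\<lambda>x. x"])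
  fix w :: "('v, 'e) lgen list"
  have "gen_weight (\<lambda>_. 1) g = (1 :: 'k)" for g :: "('v, 'e) lgen" by (cases g) auto
  then have "prod_list (map (gen_weight (\<lambda>_. 1)) w) = (1 :: 'k)" by (induction w) auto
  then show "free_twist (\<lambda>_. 1) (word w :: ('v, 'e, 'k) lfree) = word w"
    by (simp add: free_twist_basis_vec)
qed (intro pm_linearI refl)

text \<open>\<open>E\<close> is the set of twisted arrows: a singleton for a rational class, empty
  for an irrational one.\<close>

lemma weight_ghost_path:
  "prod_list (map (gen_weight (\<lambda>b. if b \<in> E then c else 1)) (ghost_path v p))
    = inverse c ^ length (filter (\<lambda>b. b \<in> E) p)"
proof -
  have "prod_list (map (gen_weight (\<lambda>b. if b \<in> E then c else 1)) (map Ghost p))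
      = inverse c ^ length (filter (\<lambda>b. b \<in> E) p)"
    by (induction p) auto
  then show ?thesis by (simp add: ghost_path_def)
qed

text \<open>If \<open>x\<close> annihilates the twisted module, so does \<open>x * g\<close>, since
  \<open>g\<close> maps the module into itself. The element \<open>y\<close> equals
  \<open>x * g\<close> in the algebra, and the twist respects this equality.\<close>

lemma annihilator_mult:
  assumes "lpa_module_basis Q B T" and nz: "\<And>b. b \<in> arcs Q \<Longrightarrow> a b \<noteq> 0"
    and ann: "\<And>f. f \<in> free_space B \<Longrightarrow> gen_act T (free_twist a x) f = 0"
    and g: "g \<in> lpa_free Q" and eq: "lpa_eq Q (x * g) y" and f: "f \<in> free_space B"
  shows "gen_act T (free_twist a y) f = 0"
proof -
  have "free_twist a (x * g - y) \<in> lpa_ideal Q"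
    using eq nz by (intro free_twist_lpa_ideal) (auto simp: lpa_eq_def)
  then have "gen_act T (free_twist a (x * g)) f - gen_act T (free_twist a y) f = 0"
    using gen_act_lpa_ideal [OF assms(1) _ f]
    unfolding pm_linear_diff [OF pm_linear_free_twist] pm_linear_diff [OF pm_linear_gen_act_left, symmetric]
    by blast
  moreover have "gen_act T (free_twist a g) f \<in> free_space B"
    using assms(1) g f free_twist_in_lpa_free
    by (intro gen_act_in_free_space) (auto simp: lpa_module_basis_def)
  ultimately show ?thesis
    by (simp add: free_twist_mult gen_act_mult ann)
qed

section \<open>Ghost paths acting on the path modules\<close>

context wf_digraph
begin

lemma F_gen_ghost_path:
  assumes "awalk v p t" and "tail G (r 0) = t"
  shows "gen_act (F_gen G) (word (ghost_path v p)) (basis_vec r) = (basis_vec (conc p r) :: _ \<Rightarrow>\<^sub>0 'k::field)"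
proof -
  \<comment> \<open>The start of the path obtained so far is carried along, because the next ghost
    arrow, and finally \<open>Vert v\<close>, act nontrivially only there.\<close>
  have "foldr (\<lambda>g. lin_ext (F_gen G g)) (map Ghost p) (basis_vec r) = (basis_vec (conc p r) :: _ \<Rightarrow>\<^sub>0 'k) \<and>
    tail G (conc p r 0) = v"
    using assms by (induction p arbitrary: v) (auto simp: awalk_simps)
  then show ?thesis
    by (simp add: gen_act_basis_vec ghost_path_def)
qed

lemma N_gen_ghost_path:
  assumes "awalk v p t"
  shows "gen_act (N_gen G) (word (ghost_path v p)) (basis_vec (t, r)) = (basis_vec (v, p @ r) :: _ \<Rightarrow>\<^sub>0 'k::field)"
proof -
  have "foldr (\<lambda>g. lin_ext (N_gen G g)) (map Ghost p) (basis_vec (t, r)) = (basis_vec (v, p @ r) :: _ \<Rightarrow>\<^sub>0 'k)"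
    using assms by (induction p arbitrary: v) (auto simp: awalk_simps)
  then show ?thesis
    by (simp add: gen_act_basis_vec ghost_path_def)
qed

text \<open>If no sink is reachable from \<open>t\<close>, every reachable vertex emits an arrow.
  Choosing one at each such vertex and iterating from \<open>t\<close> traces a left-infinite
  path.\<close>

lemma sink_or_left_inf_path:
  assumes "t \<in> verts G"
  obtains s r where "s \<in> sinks G" "awalk t r s"
  | r where "r \<in> left_inf_paths G" "tail G (r 0) = t"
proof (cases "\<exists>s r. s \<in> sinks G \<and> awalk t r s")
  case False
  define R where "R = {v. \<exists>p. awalk t p v}"
  have "\<exists>a. a \<in> arcs G \<and> tail G a = v" if "v \<in> R" for v
    using that False unfolding R_def sinks_def out_arcs_def by (force dest: awalk_last_in_verts)
  then obtain a where a: "\<And>v. v \<in> R \<Longrightarrow> a v \<in> arcs G \<and> tail G (a v) = v" by metis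
  define x where "x n = ((\<lambda>v. head G (a v)) ^^ n) t" for n
  have x: "x n \<in> R" for n
  proof (induction n)
    case 0
    have "awalk t [] t" using assms by (simp add: awalk_Nil_iff)
    then show ?case by (auto simp: R_def x_def)
  next
    case (Suc n)
    then obtain p where "awalk t p (x n)" by (auto simp: R_def)
    moreover have "awalk (x n) [a (x n)] (x (Suc n))"
      using a [OF Suc] arc_implies_awalk [of "a (x n)"] by (simp add: x_def)
    ultimately show ?case unfolding R_def by (blast intro: awalk_appendI)
  qed
  show ?thesis
  proof (rule that(2) [of "\<lambda>n. a (x n)"])
    show "(\<lambda>n. a (x n)) \<in> left_inf_paths G"
      using a [OF x] by (auto simp: left_inf_paths_def) (simp add: x_def)
    show "tail G (a (x 0)) = t"
      using a [OF x [of 0]] by (simp add: x_def)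
  qed
qed (use that(1) in blast)

lemma awalk_start_unique: "awalk v p t \<Longrightarrow> awalk v' p t \<Longrightarrow> v = v'"
  by (cases p) (auto simp: awalk_simps)

lemma ghost_span_keysD:
  assumes "y \<in> ghost_span t" "w \<in> Poly_Mapping.keys y"
  obtains v p where "w = ghost_path v p" "awalk v p t"
  using assms by (auto simp: ghost_span_def free_space_def)

lemma ghost_span_annihilated_F:
  fixes y :: "('a, 'b, 'k::field) lfree"
  assumes inf: "infinite (UNIV :: 'k set)" and y: "y \<in> ghost_span t"
    and r: "r \<in> left_inf_paths G" "tail G (r 0) = t"
    and ann: "\<And>c. c \<noteq> 0 \<Longrightarrow>
      gen_act (F_gen G) (free_twist (\<lambda>b. if b \<in> E then c else 1) y) (basis_vec r) = 0"
    and meets: "\<And>d. d \<noteq> [] \<Longrightarrow> r = cycle_inf d \<Longrightarrow> awalk t d t \<Longrightarrow> \<exists>b\<in>E. b \<in> set d"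
  shows "y = 0"
\<comment> \<open>The idea is to separate paths with the same image: two of them differ by a cycle
  at \<open>t\<close> whose repetition is \<open>r\<close>, and \<open>meets\<close> puts a twisted
  arrow on that cycle, so their exponents of the parameter differ.\<close>
proof -
  define path :: "('a, 'b) lgen list \<Rightarrow> 'b list" where
    "path w = map (\<lambda>g. case g of Ghost b \<Rightarrow> b) (tl w)" for w
  have path: "path (ghost_path v p) = p" for v p
    by (simp add: path_def ghost_path_def comp_def)
  define weight :: "'b list \<Rightarrow> nat" where "weight p = length (filter (\<lambda>b. b \<in> E) p)" for p
  have indep: "Poly_Mapping.lookup y w = 0" if "w \<in> Poly_Mapping.keys y" for w
  proof (rule scaled_family_independent [where c = "Poly_Mapping.lookup y"
        and n = "\<lambda>w. weight (path w)" and g = "\<lambda>w. conc (path w) r", OF inf finite_keys _ _ that])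
    fix c :: 'k assume c: "c \<noteq> 0"
    \<comment> \<open>Ghosts carry inverse weights; twisting by \<open>inverse c\<close> therefore
      produces nonnegative powers of \<open>c\<close>, as a polynomial argument needs.\<close>
    let ?h = "\<lambda>y. gen_act (F_gen G) (free_twist (\<lambda>b. if b \<in> E then inverse c else 1) y) (basis_vec r)"
    have "?h (word w) = pm_scale (c ^ weight (path w)) (basis_vec (conc (path w) r))"
      if w: "w \<in> Poly_Mapping.keys y" for w
    proof -
      obtain v p where "w = ghost_path v p" "awalk v p t"
        using ghost_span_keysD [OF y w] .
      then show ?thesis
        using F_gen_ghost_path [of v p t r, where 'k='k] r(2)
        by (simp add: free_twist_basis_vec weight_ghost_path path weight_def
            pm_linear_scale [OF pm_linear_gen_act_left])
    qed
    then have "(\<Sum>w\<in>Poly_Mapping.keys y. pm_scale (Poly_Mapping.lookup y w * c ^ weight (path w))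
        (basis_vec (conc (path w) r))) = ?h y"
      by (subst pm_linear_expand [of ?h]) (auto intro: pm_linear_comp [OF pm_linear_gen_act_left pm_linear_free_twist])
    also have "\<dots> = 0" using c by (intro ann) simp
    finally show "(\<Sum>w\<in>Poly_Mapping.keys y. pm_scale (Poly_Mapping.lookup y w * c ^ weight (path w))
        (basis_vec (conc (path w) r))) = 0" .
  next
    have *: "v = v' \<and> p = p'"
      if walks: "awalk v p t" "awalk v' p' t" and eq: "conc p r = conc p' r"
        "weight p = weight p'" and le: "length p \<le> length p'" for v v' p p'
    proof -
      obtain d where d: "p' = p @ d" "conc d r = r"
        using conc_eq_prefix [OF eq(1) le] .
      have "d = []"
      proof (rule ccontr)
        assume "d \<noteq> []"
        obtain u where u: "awalk u d t" using walks(2) d(1) by auto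
        \<comment> \<open>The remainder \<open>d\<close> ends at \<open>t\<close>; since its first
          arrow is that of \<open>r\<close>, it also starts at \<open>t\<close> and is a
          cycle.\<close>
        have "r 0 = hd d"
          using conc_nth [of d r 0] d(2) \<open>d \<noteq> []\<close> by (simp add: hd_conv_nth)
        then have "u = t" using u \<open>d \<noteq> []\<close> r(2) by (cases d) (auto simp: awalk_simps)
        then have "\<exists>b\<in>E. b \<in> set d"
          using meets conc_fixed_point [OF d(2)] u \<open>d \<noteq> []\<close> by simp
        \<comment> \<open>A twisted arrow in \<open>d\<close> would give \<open>p @ d\<close> a
          larger weight than \<open>p\<close>.\<close>
        then show False using eq(2) d(1) by (auto simp: weight_def filter_empty_conv)
      qed
      then show ?thesis using walks d(1) awalk_start_unique by simp
    qed
    fix w w' assume w: "w \<in> Poly_Mapping.keys y" "w' \<in> Poly_Mapping.keys y"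
      and eq: "conc (path w) r = conc (path w') r" "weight (path w) = weight (path w')"
    obtain v p where vp: "w = ghost_path v p" "awalk v p t" using ghost_span_keysD [OF y w(1)] .
    obtain v' p' where vp': "w' = ghost_path v' p'" "awalk v' p' t" using ghost_span_keysD [OF y w(2)] .
    show "w = w'"
      using *[OF vp(2) vp'(2)] *[OF vp'(2) vp(2)] eq vp(1) vp'(1)
      by (cases "length p \<le> length p'") (auto simp: path)
  qed
  show ?thesis
    by (rule poly_mapping_eqI) (metis indep in_keys_iff lookup_zero)
qed

lemma ghost_span_annihilated_N:
  fixes y :: "('a, 'b, 'k::field) lfree"
  assumes inf: "infinite (UNIV :: 'k set)" and y: "y \<in> ghost_span t"
    and ann: "gen_act (N_gen G) y (basis_vec (t, r)) = 0"
  shows "y = 0"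
proof -
  define src :: "('a, 'b) lgen list \<Rightarrow> 'a" where "src w = lgen_source G (hd w)" for w
  define path :: "('a, 'b) lgen list \<Rightarrow> 'b list" where
    "path w = map (\<lambda>g. case g of Ghost b \<Rightarrow> b) (tl w)" for w
  have path: "path (ghost_path v p) = p" for v p
    by (simp add: path_def ghost_path_def comp_def)
  have src: "src (ghost_path v p) = v" for v p
    by (simp add: src_def ghost_path_def)
  have indep: "Poly_Mapping.lookup y w = 0" if "w \<in> Poly_Mapping.keys y" for w
  proof (rule scaled_family_independent [where c = "Poly_Mapping.lookup y"
        \<comment> \<open>Here \<open>r\<close> is a finite list and cancels from
          \<open>path w @ r\<close>. Distinct ghost paths have distinct images without any twist, so
          the constant exponent 0 works.\<close>
        and n = "\<lambda>_. 0" and g = "\<lambda>w. (src w, path w @ r)", OF inf finite_keys _ _ that])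
    let ?h = "\<lambda>y. gen_act (N_gen G) y (basis_vec (t, r))"
    have "?h (word w) = (basis_vec (src w, path w @ r) :: _ \<Rightarrow>\<^sub>0 'k)" if w: "w \<in> Poly_Mapping.keys y" for w
    proof -
      obtain v p where "w = ghost_path v p" "awalk v p t"
        using ghost_span_keysD [OF y w] .
      then show ?thesis by (simp add: N_gen_ghost_path path src)
    qed
    then have "(\<Sum>w\<in>Poly_Mapping.keys y. pm_scale (Poly_Mapping.lookup y w) (basis_vec (src w, path w @ r))) = ?h y"
      by (subst pm_linear_expand [of ?h]) (auto intro: pm_linear_gen_act_left)
    then show "(\<Sum>w\<in>Poly_Mapping.keys y. pm_scale (Poly_Mapping.lookup y w * c ^ 0) (basis_vec (src w, path w @ r))) = 0" for c :: 'k
      using ann by simp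
  next
    fix w w' assume w: "w \<in> Poly_Mapping.keys y" "w' \<in> Poly_Mapping.keys y"
      and eq: "(src w, path w @ r) = (src w', path w' @ r)"
    obtain v p where "w = ghost_path v p" using ghost_span_keysD [OF y w(1)] .
    moreover obtain v' p' where "w' = ghost_path v' p'" using ghost_span_keysD [OF y w(2)] .
    ultimately show "w = w'" using eq by (simp add: path src)
  qed
  show ?thesis
    by (rule poly_mapping_eqI) (metis indep in_keys_iff lookup_zero)
qed

end

text \<open>The action in \<open>basis_repr\<close> does not depend on the basis set, so shrinking
  the space to a class is the same as starting from that class as basis.\<close>

lemma F_class_eq_basis_repr: "F_class Q C = basis_repr C (F_gen Q)"
  by (simp add: F_class_def F_repr_def basis_repr_def)

lemma N_sink_eq_basis_repr: "N_sink Q i = basis_repr (paths_ending_at Q i) (N_gen Q)"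
  by (simp add: N_sink_def N_repr_def basis_repr_def)

theorem proposition6p3:
  fixes Q :: "('v, 'e) pre_digraph"
    and q :: "(nat \<Rightarrow> 'e) set \<Rightarrow> 'e list"
  assumes "wf_digraph Q"
    and "row_finite Q"
    and "infinite (UNIV :: 'k::field set)"
    and "\<And>C. C \<in> rational_classes Q \<Longrightarrow> simple_cycle Q (q C)"
    and "\<And>C p. C \<in> rational_classes Q \<Longrightarrow> p \<in> C \<Longrightarrow> tail_equiv p (cycle_inf (q C))"
  shows "faithful_repr (lpa Q :: ('k, ('v, 'e, 'k) lfree set) nalgebra)
     (direct_sum (irrational_classes Q) (\<lambda>C. F_class Q C)
      \<oplus> direct_sum {(c, C). c \<noteq> 0 \<and> C \<in> rational_classes Q}
          (\<lambda>(c, C). twisted Q (first_arrow_weight c (q C)) (F_class Q C))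
      \<oplus> direct_sum (sinks Q) (\<lambda>i. N_sink Q i))"
proof -
  interpret wf_digraph Q by fact
  let ?A = "lpa Q :: ('k, ('v, 'e, 'k) lfree set) nalgebra"
  let ?F = "\<lambda>C. F_class Q C :: ('v, 'e, 'k, (nat \<Rightarrow> 'e) \<Rightarrow>\<^sub>0 'k) lpa_repr"
  let ?N = "\<lambda>i. N_sink Q i :: ('v, 'e, 'k, ('v \<times> 'e list) \<Rightarrow>\<^sub>0 'k) lpa_repr"
  let ?tw = "\<lambda>(c, C). twisted Q (first_arrow_weight c (q C)) (?F C)"
  let ?R = "{(c :: 'k, C). c \<noteq> 0 \<and> C \<in> rational_classes Q}"
  let ?S1 = "direct_sum (irrational_classes Q) ?F"
  let ?S2 = "direct_sum ?R ?tw"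
  let ?S3 = "direct_sum (sinks Q) ?N"
  have F: "lpa_module_basis Q C (F_gen Q :: _ \<Rightarrow> _ \<Rightarrow> (_ \<Rightarrow>\<^sub>0 'k))"
    if C: "C \<in> irrational_classes Q \<union> rational_classes Q" for C
  proof -
    obtain p where "C = tail_class Q p"
      using C by (auto simp: irrational_classes_def rational_classes_def)
    then show ?thesis
      using tail_class_tau [of _ Q p] tail_class_Cons [of _ Q p]
      by (intro lpa_module_basis_F) (auto simp: tail_class_def)
  qed
  note N = lpa_module_basis_N [OF assms(1), where 'k='k]
  have F_repr: "is_repr ?A (?F C)" if "C \<in> irrational_classes Q \<union> rational_classes Q" for C
    unfolding F_class_eq_basis_repr by (intro is_repr_basis_repr F assms(1) that)
  have N_repr: "is_repr ?A (?N i)" if "i \<in> sinks Q" for i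
    unfolding N_sink_eq_basis_repr by (intro is_repr_basis_repr N assms(1) that)
  have nz: "first_arrow_weight c w b \<noteq> 0" if "c \<noteq> 0" for c :: 'k and w :: "'e list" and b
    using that by (simp add: first_arrow_weight_def)
  have tw_repr: "is_repr ?A (?tw i)" if "i \<in> ?R" for i
    using that by (auto intro!: is_repr_twisted [OF assms(1)] F_repr nz)
  have S1: "is_repr ?A ?S1"
    by (intro is_repr_direct_sum F_repr)
      (simp_all add: F_class_eq_basis_repr basis_repr_def vector_space_pm_scale)
  have S2: "is_repr ?A ?S2"
    by (rule is_repr_direct_sum [OF _ tw_repr])
      (auto simp: twisted_def F_class_eq_basis_repr basis_repr_def vector_space_pm_scale)
  have S3: "is_repr ?A ?S3"
    by (intro is_repr_direct_sum N_repr)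
      (simp_all add: N_sink_eq_basis_repr basis_repr_def vector_space_pm_scale)
  have S23: "is_repr ?A (?S2 \<oplus> ?S3)"
    by (intro is_repr_dsum2 S2 S3)
  have S: "is_repr ?A (?S1 \<oplus> ?S2 \<oplus> ?S3)"
    by (intro is_repr_dsum2 S1 S23)
  have "inj_on (repr_hom (?S1 \<oplus> ?S2 \<oplus> ?S3)) (acarrier ?A)"
  proof (rule inj_onI)
    fix X Y assume XY: "X \<in> acarrier ?A" "Y \<in> acarrier ?A"
      and eq: "repr_hom (?S1 \<oplus> ?S2 \<oplus> ?S3) X = repr_hom (?S1 \<oplus> ?S2 \<oplus> ?S3) Y"
    obtain u u' where u: "u \<in> lpa_free Q" "u' \<in> lpa_free Q" "X = lpa_coset Q u" "Y = lpa_coset Q u'"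
      using XY by (auto simp: acarrier_lpa)
    \<comment> \<open>Equality of the cosets means that this difference lies in the ideal. Below,
      \<open>x\<close> is shown to annihilate every summand, with the twist moved from the module to
      \<open>x\<close>.\<close>
    define x where "x = u - u'"
    have x: "x \<in> lpa_free Q" unfolding x_def by (intro lpa_free_diff u)
    note eq23 = repr_hom_dsum2_eqD(2) [OF eq S1 S23]
    have space: "rspace (?F C) = free_space C" "rspace (?N i) = free_space (paths_ending_at Q i)" for C i
      by (simp_all add: F_class_eq_basis_repr N_sink_eq_basis_repr basis_repr_def)
    have ann_irr: "gen_act (F_gen Q) x f = 0" if C: "C \<in> irrational_classes Q" and f: "f \<in> free_space C" for C f
    proof -
      have "ract (?F C) X f = ract (?F C) Y f"
        by (rule repr_hom_direct_sum_eqD [OF repr_hom_dsum2_eqD(1) [OF eq S1 S23] F_repr XY C])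
          (use f space in auto)
      then show ?thesis
        using C f by (simp add: u F_class_eq_basis_repr ract_basis_repr [OF F] x_def
            pm_linear_diff [OF pm_linear_gen_act_left])
    qed
    have ann_rat: "gen_act (F_gen Q) (free_twist (first_arrow_weight c (q C)) x) f = 0"
      if C: "C \<in> rational_classes Q" and c: "c \<noteq> 0" and f: "f \<in> free_space C" for c C f
    proof -
      have "ract (?tw (c, C)) X f = ract (?tw (c, C)) Y f"
        by (rule repr_hom_direct_sum_eqD [OF repr_hom_dsum2_eqD(1) [OF eq23 S2 S3] tw_repr XY])
          (use C c f space in \<open>auto simp: twisted_def\<close>)
      then show ?thesis
        using C f by (simp add: twisted_def lpa_twist_coset nz [OF c] u F_class_eq_basis_repr
            ract_basis_repr [OF F] x_def pm_linear_diff [OF pm_linear_gen_act_left]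
            pm_linear_diff [OF pm_linear_free_twist])
    qed
    have ann_sink: "gen_act (N_gen Q) x f = 0" if i: "i \<in> sinks Q" and f: "f \<in> free_space (paths_ending_at Q i)" for i f
    proof -
      have "ract (?N i) X f = ract (?N i) Y f"
        by (rule repr_hom_direct_sum_eqD [OF repr_hom_dsum2_eqD(2) [OF eq23 S2 S3] N_repr XY i])
          (use f space in auto)
      then show ?thesis
        using i f by (simp add: u N_sink_eq_basis_repr ract_basis_repr [OF N] x_def
            pm_linear_diff [OF pm_linear_gen_act_left])
    qed
    have "x \<in> lpa_ideal Q"
    proof (rule lpa_ideal_if_ghost_span [OF assms(2) x])
      fix v p t y
      assume vp: "awalk v p t" and y: "y \<in> ghost_span t" and xy: "lpa_eq Q (x * word (ghost_path v p)) y"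
      have g: "(word (ghost_path v p) :: ('v, 'e, 'k) lfree) \<in> lpa_free Q"
        using set_ghost_path [OF vp] by (simp add: ghost_path_def)
      show "y = 0"
      proof (cases rule: sink_or_left_inf_path [OF awalk_last_in_verts [OF vp]])
        case (1 s r)
        then have "basis_vec (t, r) \<in> (free_space (paths_ending_at Q s) :: (_ \<Rightarrow>\<^sub>0 'k) set)"
          by (simp add: paths_ending_at_def)
        \<comment> \<open>The twist by the constant 1 is the identity; it brings the untwisted
          summand into the form of \<open>annihilator_mult\<close>.\<close>
        then have "gen_act (N_gen Q) (free_twist (\<lambda>_. 1) y) (basis_vec (t, r)) = 0"
          using 1 ann_sink by (intro annihilator_mult [OF N _ _ g xy]) (auto simp: free_twist_one)
        then show ?thesis
          using ghost_span_annihilated_N [OF assms(3) y] by (simp add: free_twist_one)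
      next
        case (2 r)
        define C where "C = tail_class Q r"
        have r: "basis_vec r \<in> (free_space C :: (_ \<Rightarrow>\<^sub>0 'k) set)"
          using 2(1) by (simp add: C_def tail_class_def)
        show ?thesis
        proof (cases "rational_path Q r")
          case True
          then have C: "C \<in> rational_classes Q" by (auto simp: C_def rational_classes_def)
          show ?thesis
          proof (rule ghost_span_annihilated_F [OF assms(3) y 2, of "{hd (q C)}"])
            fix c :: 'k assume c: "c \<noteq> 0"
            have "gen_act (F_gen Q) (free_twist (first_arrow_weight c (q C)) y) (basis_vec r) = 0"
              using C c ann_rat nz by (intro annihilator_mult [OF F _ _ g xy r]) auto
            then show "gen_act (F_gen Q) (free_twist (\<lambda>b. if b \<in> {hd (q C)} then c else 1) y) (basis_vec r) = 0"
              by (simp add: first_arrow_weight_def)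
          next
            fix d assume d: "d \<noteq> []" "r = cycle_inf d"
            have "q C \<noteq> []"
              using assms(4) [OF C] by (simp add: simple_cycle_def oriented_cycle_def)
            \<comment> \<open>The path \<open>r\<close> is tail-equivalent to the repetition of
              \<open>q C\<close> and so passes through its first arrow. As \<open>r\<close> also
              repeats \<open>d\<close>, that arrow lies on \<open>d\<close>.\<close>
            then have "hd (q C) \<in> range r"
              using assms(5) [OF C, of r] r by (intro tail_equiv_cycle_inf) simp_all
            then show "\<exists>b\<in>{hd (q C)}. b \<in> set d"
              using d by (auto simp: cycle_inf_def)
          qed
        next
          case False
          then have C: "C \<in> irrational_classes Q"
            using 2(1) by (auto simp: C_def irrational_classes_def)
          show ?thesis
          proof (rule ghost_span_annihilated_F [OF assms(3) y 2, of "{}"])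
            have "gen_act (F_gen Q) (free_twist (\<lambda>_. 1) y) (basis_vec r) = 0"
              using C ann_irr by (intro annihilator_mult [OF F _ _ g xy r]) (auto simp: free_twist_one)
            then show "gen_act (F_gen Q) (free_twist (\<lambda>b. if b \<in> {} then c else 1) y) (basis_vec r) = 0" for c :: 'k
              by simp
          next
            fix d assume "d \<noteq> []" "r = cycle_inf d" "awalk t d t"
            \<comment> \<open>With no twisted arrow available, a cycle \<open>d\<close> must be
              excluded altogether; it would make \<open>r\<close> cyclic, hence rational.\<close>
            then have "rational_path Q r"
              using 2(1) unfolding rational_path_def oriented_cycle_def by (blast intro: tail_equiv_refl)
            with False show "\<exists>b\<in>{}. b \<in> set d" by simp
          qed
        qed
      qed
    qed
    then show "X = Y" by (simp add: u x_def lpa_coset_eq_iff)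
  qed
  with S show ?thesis by (simp add: faithful_repr_def)
qed

end
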